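(* Let $D=(0,1)$. Let $\chi_1,\chi_2$ be real-valued functions on $D$ with $M:=\|\chi_1\|_{L^\infty}+\|\chi_2\|_{L^\infty}<\infty$ and $\chi_2(x)>0$ for a.e. $x\in D$, and let $q\in C^1[0,1]$ be real-valued with $Q:=\|q\|_{L^\infty}>0$. For any $r>0$ there exists $\delta=\delta(r,Q,M,\chi_2)>0$ (depending only on $r,Q,M,\chi_2$) such that if $\omega\in\mathbb{C}$ with $0<|\omega|<\delta$ and $\bm{u}\in X$ with $0<\|\bm{u}\|_X<r$, then $$T_\omega(\bm{u})\neq 0.$$
   Context: All functions in $L^2=L^2(0,1)$ and $H^2=H^2(0,1)$ are complex-valued. $H^2$ carries the inner product $\langle u,v\rangle_{H^2}=\langle u,v\rangle_{L^2}+\langle u'',v''\rangle_{L^2}$ (its norm is equivalent to the standard one). $X=H^2\times L^2$, with elements $\bm{u}=(u_1,u_2)$, inner product $\langle\bm{u},\bm{\phi}\rangle_X=\langle u_1,\phi_1\rangle_{H^2}+\langle u_2,\phi_2\rangle_{L^2}$ and induced norm $\|\cdot\|_X$. For $\omega\in\mathbb{C}$, the (nonlinear) operator $T_\omega:X\to X$ is defined via the Riesz representation theorem by requiring, for all $\bm{u},\bm{\phi}\in X$, $$\langle T_\omega(\bm{u}),\bm{\phi}\rangle_X=\int_0^1\left[(u_1''+\omega^2 q u_1)\overline{\phi}_2+\omega^2\chi_1u_2\overline{u}_1\overline{\phi}_2\right]dx+\int_0^1\left[u_2(\overline{\phi}_1''+4\omega^2q\overline{\phi}_1)+\omega^2\chi_2u_1^2\overline{\phi}_1\right]dx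 .$$ *)

theory Defs
  imports "HOL-Analysis.Analysis" "HOL-Probability.Essential_Supremum"
begin

abbreviation leb01 :: "real measure" where
  "leb01 \<equiv> lebesgue_on {0<..<1}"

definition square_integrable :: "(real \<Rightarrow> complex) \<Rightarrow> bool" where
  "square_integrable f \<longleftrightarrow>
     f \<in> borel_measurable leb01 \<and> integrable leb01 (\<lambda>x. (cmod (f x))\<^sup>2)"

definition l2_eq :: "(real \<Rightarrow> complex) \<Rightarrow> (real \<Rightarrow> complex) \<Rightarrow> bool" where
  "l2_eq f g \<longleftrightarrow> square_integrable f \<and> square_integrable g \<and> (AE x in leb01. f x = g x)"

text \<open>
  Elements of \<open>l2\<close> are genuine almost-everywhere classes.  The function \<open>rep_l2\<close> picks some
  square-integrable representative; all uses below are under integrals over \<open>(0,1)\<close> and hence do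
  not depend on that choice.
\<close>

quotient_type l2 = "real \<Rightarrow> complex" / partial: l2_eq
proof (rule part_equivpI)
  show "\<exists>f. l2_eq f f"
    by (rule exI[of _ "\<lambda>_. 0"]) (simp add: l2_eq_def square_integrable_def)
  show "symp l2_eq"
    by (rule sympI) (auto simp: l2_eq_def elim: AE_mp)
  show "transp l2_eq"
    by (rule transpI) (auto simp: l2_eq_def elim!: AE_mp)
qed

instantiation l2 :: zero
begin

lift_definition zero_l2 :: l2 is "\<lambda>_. 0"
  by (simp add: l2_eq_def square_integrable_def)

instance ..

end

definition inner_L2 :: "l2 \<Rightarrow> l2 \<Rightarrow> complex" where
  "inner_L2 u v = (LINT x|leb01. rep_l2 u x * cnj (rep_l2 v x))"

text \<open>
  Test functions \<open>C\<^sub>c\<^sup>\<infinity>(0,1)\<close>.  By linearity, real-valued ones suffice to determine weak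
  derivatives of complex-valued functions.
\<close>

definition test_function :: "(real \<Rightarrow> real) \<Rightarrow> bool" where
  "test_function \<psi> \<longleftrightarrow>
     (\<forall>k x. (deriv ^^ k) \<psi> field_differentiable (at x)) \<and>
     (\<exists>K. compact K \<and> K \<subseteq> {0<..<1} \<and> (\<forall>x. x \<notin> K \<longrightarrow> \<psi> x = 0))"

definition has_weak_deriv :: "l2 \<Rightarrow> l2 \<Rightarrow> bool" where
  "has_weak_deriv u v \<longleftrightarrow>
     (\<forall>\<psi>. test_function \<psi> \<longrightarrow>
        (LINT x|leb01. rep_l2 u x * of_real (deriv \<psi> x)) =
        - (LINT x|leb01. rep_l2 v x * of_real (\<psi> x)))"

definition weak_deriv :: "l2 \<Rightarrow> l2" where
  "weak_deriv u = (THE v. has_weak_deriv u v)"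

definition H2 :: "l2 set" where
  "H2 = {u. \<exists>v w. has_weak_deriv u v \<and> has_weak_deriv v w}"

definition weak_deriv2 :: "l2 \<Rightarrow> l2" where
  "weak_deriv2 u = weak_deriv (weak_deriv u)"

definition inner_H2 :: "l2 \<Rightarrow> l2 \<Rightarrow> complex" where
  "inner_H2 u v = inner_L2 u v + inner_L2 (weak_deriv2 u) (weak_deriv2 v)"

definition X_space :: "(l2 \<times> l2) set" where
  "X_space = H2 \<times> UNIV"

definition inner_X :: "l2 \<times> l2 \<Rightarrow> l2 \<times> l2 \<Rightarrow> complex" where
  "inner_X u \<phi> = inner_H2 (fst u) (fst \<phi>) + inner_L2 (snd u) (snd \<phi>)"

definition norm_X :: "l2 \<times> l2 \<Rightarrow> real" where
  "norm_X u = sqrt (Re (inner_X u u))"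

definition T_form ::
  "(real \<Rightarrow> real) \<Rightarrow> (real \<Rightarrow> real) \<Rightarrow> (real \<Rightarrow> real) \<Rightarrow> complex \<Rightarrow>
   l2 \<times> l2 \<Rightarrow> l2 \<times> l2 \<Rightarrow> complex" where
  "T_form \<chi>1 \<chi>2 q \<omega> u \<phi> =
    (let u1 = rep_l2 (fst u); u1'' = rep_l2 (weak_deriv2 (fst u)); u2 = rep_l2 (snd u);
         \<phi>1 = rep_l2 (fst \<phi>); \<phi>1'' = rep_l2 (weak_deriv2 (fst \<phi>)); \<phi>2 = rep_l2 (snd \<phi>)
     in (LINT x|leb01. (u1'' x + \<omega>\<^sup>2 * of_real (q x) * u1 x) * cnj (\<phi>2 x)
                       + \<omega>\<^sup>2 * of_real (\<chi>1 x) * u2 x * cnj (u1 x) * cnj (\<phi>2 x))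
      + (LINT x|leb01. u2 x * (cnj (\<phi>1'' x) + 4 * \<omega>\<^sup>2 * of_real (q x) * cnj (\<phi>1 x))
                       + \<omega>\<^sup>2 * of_real (\<chi>2 x) * (u1 x)\<^sup>2 * cnj (\<phi>1 x)))"

text \<open>
  The Riesz representative of the bounded antilinear functional \<open>T_form \<chi>1 \<chi>2 q \<omega> u\<close> on \<open>X_space\<close>.
\<close>

definition T_op ::
  "(real \<Rightarrow> real) \<Rightarrow> (real \<Rightarrow> real) \<Rightarrow> (real \<Rightarrow> real) \<Rightarrow> complex \<Rightarrow> l2 \<times> l2 \<Rightarrow> l2 \<times> l2" where
  "T_op \<chi>1 \<chi>2 q \<omega> u =
     (THE w. w \<in> X_space \<and> (\<forall>\<phi>\<in>X_space. inner_X w \<phi> = T_form \<chi>1 \<chi>2 q \<omega> u \<phi>))"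

definition Linf_norm :: "(real \<Rightarrow> real) \<Rightarrow> ereal" where
  "Linf_norm f = esssup leb01 (\<lambda>x. ereal \<bar>f x\<bar>)"

text \<open>One-sided derivatives at the end points; \<open>C1_differentiable_on\<close> would ask for two-sided ones.\<close>

definition C1_01 :: "(real \<Rightarrow> real) \<Rightarrow> bool" where
  "C1_01 q \<longleftrightarrow>
     (\<exists>q'. continuous_on {0..1} q' \<and>
           (\<forall>x\<in>{0..1}. (q has_real_derivative q' x) (at x within {0..1})))"

end

theory Submission
  imports Defs "HOL-Probability.Probability_Measure"
begin

text \<open>
  A zero \<open>u = (u\<^sub>1, u\<^sub>2)\<close> of \<open>T\<^sub>\<omega>\<close> satisfies
  \<open>u\<^sub>1'' = - \<omega>\<^sup>2 (q u\<^sub>1 + \<chi>\<^sub>1 u\<^sub>2 cnj u\<^sub>1)\<close> and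
  \<open>\<integral> u\<^sub>2 (cnj \<phi>'' + 4 \<omega>\<^sup>2 q cnj \<phi>) + \<omega>\<^sup>2 \<chi>\<^sub>2 u\<^sub>1\<^sup>2 cnj \<phi> = 0\<close> for all \<open>\<phi> \<in> H\<^sup>2\<close>.
  The first equation makes \<open>u\<^sub>1\<close> affine up to a relative error \<open>O(|\<omega>|\<^sup>2)\<close>; testing the second
  one with \<open>\<phi>'' = u\<^sub>2\<close> gives \<open>u\<^sub>2 = O(|\<omega>|\<^sup>2 |u\<^sub>1|\<^sup>2)\<close>, and testing it with \<open>\<phi> = 1, x\<close>, where \<open>\<phi>'' = 0\<close>,
  gives \<open>\<integral> \<chi>\<^sub>2 u\<^sub>1\<^sup>2 \<phi> = O(|\<omega>|\<^sup>2 |u\<^sub>1|\<^sup>2)\<close>.  For affine \<open>l \<noteq> 0\<close> the two moments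
  \<open>\<integral> \<chi>\<^sub>2 l\<^sup>2\<close> and \<open>\<integral> \<chi>\<^sub>2 l\<^sup>2 x\<close> do not both vanish, so by compactness they bound \<open>|l|\<^sup>2\<close> from below,
  which forces \<open>u = 0\<close> for small \<open>|\<omega>|\<close>.

  As \<open>T_op\<close> is a definite description, the Riesz representative has to be shown to exist before
  \<open>T_op = 0\<close> has any content.
\<close>

section \<open>Smooth cut-off functions\<close>

text \<open>Two obstacles shape the proof. The moments contain the square of u1, not its modulus
  squared, so for complex coefficients positivity of \<open>\<chi>2\<close> does not bound the
  zeroth moment from below: for weight 1 and l(x) = x - 1/2 - i / sqrt 12 it vanishes. The moment
  against x excludes such non-real roots. The second obstacle is that \<open>l2\<close> is a bare
  quotient without linear or metric structure, so the Riesz representative is constructed by hand.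
  Elements of \<open>H2\<close> are put into the normal form "affine plus double primitive of the
  second derivative", and the representative then comes from an integral equation. The normal form
  rests on the fact that a function with zero weak derivative is constant, and this needs explicit
  test functions, hence the cut-offs. Uniformity of \<delta>: \<open>\<chi>1\<close> and
  \<open>q\<close> enter only through the bounds \<open>M\<close> and \<open>Q\<close>,
  \<open>r\<close> controls u2 in the product of u2 and cnj u1, and the compactness argument
  involves only \<open>\<chi>2\<close> and two complex coefficients.\<close>

definition flat :: "nat \<Rightarrow> real \<Rightarrow> real" where
  "flat k x = (if 0 < x then (1 / x) ^ k * exp (- (1 / x)) else 0)"

lemma flat_tendsto_0: "((\<lambda>x. (1 / x) ^ k * exp (- (1 / x))) \<longlongrightarrow> 0) (at_right (0::real))"
proof -
  have "((\<lambda>x. inverse x ^ k / exp (inverse x)) \<longlongrightarrow> 0) (at_right (0::real))"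
    by (rule filterlim_compose[OF tendsto_power_div_exp_0 filterlim_inverse_at_top_right])
  then show ?thesis
    by (simp add: exp_minus divide_inverse)
qed

text \<open>The derivative of x^(-k) exp(-1/x) is x^(-k-2) exp(-1/x) - k x^(-k-1) exp(-1/x), so
  carrying the powers along keeps derivatives in the span of the family. At 0 the right difference
  quotient is \<open>flat (k + 1) h\<close>, which tends to 0.\<close>

lemma flat_has_derivative:
  "(flat k has_real_derivative (flat (k + 2) x - of_nat k * flat (k + 1) x)) (at x)"
proof -
  consider "x > 0" | "x < 0" | "x = 0" by linarith
  then show ?thesis
  proof cases
    case 1
    have "((\<lambda>x. (1 / x) ^ k * exp (- (1 / x))) has_real_derivative
        (flat (k + 2) x - of_nat k * flat (k + 1) x)) (at x)"
    proof -
      have y: "((\<lambda>x. 1 / x) has_real_derivative (- ((1 / x) * (1 / x)))) (at x)"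
        using 1 by (auto intro!: derivative_eq_intros simp: field_simps)
      show ?thesis
        by (rule DERIV_cong[OF DERIV_mult[OF DERIV_power[OF y] DERIV_fun_exp[OF DERIV_minus[OF y]]]])
          (use 1 in \<open>cases k; simp add: flat_def algebra_simps power2_eq_square\<close>)
    qed
    then show ?thesis
      by (rule has_field_derivative_transform_within_open[where S = "{0<..}"])
        (use 1 in \<open>auto simp: flat_def\<close>)
  next
    case 2
    have "((\<lambda>x. 0) has_real_derivative 0) (at x)" by simp
    then have "(flat k has_real_derivative 0) (at x)"
      by (rule has_field_derivative_transform_within_open[where S = "{..<0}"])
        (use 2 in \<open>auto simp: flat_def\<close>)
    then show ?thesis using 2 by (simp add: flat_def)
  next
    case 3
    have r: "((\<lambda>h. flat k h / h) \<longlongrightarrow> 0) (at_right 0)"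
    proof (rule Lim_transform_eventually[OF flat_tendsto_0[of "Suc k"]])
      show "\<forall>\<^sub>F x in at_right 0. (1 / x) ^ Suc k * exp (- (1 / x)) = flat k x / x"
        by (rule eventually_at_rightI[of 0 1]) (auto simp: flat_def)
    qed
    have l: "((\<lambda>h. flat k h / h) \<longlongrightarrow> 0) (at_left 0)"
    proof (rule Lim_transform_eventually[OF tendsto_const])
      show "\<forall>\<^sub>F x in at_left 0. 0 = flat k x / x"
        by (rule eventually_at_leftI[of "-1" 0]) (auto simp: flat_def)
    qed
    have "((\<lambda>h. flat k h / h) \<longlongrightarrow> 0) (at 0)"
      using l r by (rule filterlim_split_at)
    then show ?thesis using 3 by (simp add: DERIV_def flat_def)
  qed
qed

text \<open>An algebra of functions that contains the standard cut-offs and is closed under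
  differentiation, so that all its members are smooth.\<close>

inductive_set flat_algebra :: "(real \<Rightarrow> real) set" where
  flat_affine: "(\<lambda>x. flat k (c * x + d)) \<in> flat_algebra"
| const: "(\<lambda>x. c) \<in> flat_algebra"
| add: "f \<in> flat_algebra \<Longrightarrow> g \<in> flat_algebra \<Longrightarrow> (\<lambda>x. f x + g x) \<in> flat_algebra"
| mult: "f \<in> flat_algebra \<Longrightarrow> g \<in> flat_algebra \<Longrightarrow> (\<lambda>x. f x * g x) \<in> flat_algebra"

lemma flat_algebra_derivative:
  assumes "f \<in> flat_algebra"
  shows "\<exists>f'\<in>flat_algebra. \<forall>x. (f has_real_derivative f' x) (at x)"
  using assms
proof induction
  case (flat_affine k c d)
  let ?f' = "\<lambda>x. c * (flat (k + 2) (c * x + d) + (- of_nat k) * flat (k + 1) (c * x + d))"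
  have "?f' \<in> flat_algebra"
    by (intro flat_algebra.intros)
  moreover have "((\<lambda>x. flat k (c * x + d)) has_real_derivative ?f' x) (at x)" for x
  proof -
    have "((\<lambda>x. flat k (c * x + d)) has_real_derivative
        (flat (k + 2) (c * x + d) - of_nat k * flat (k + 1) (c * x + d)) * c) (at x)"
      by (rule DERIV_chain2[OF flat_has_derivative]) (auto intro!: derivative_eq_intros)
    then show ?thesis by (simp add: mult.commute)
  qed
  ultimately show ?case by (intro bexI[of _ ?f'] allI)
next
  case (const c)
  then show ?case
    by (intro bexI[of _ "\<lambda>x. 0"]) (auto intro: flat_algebra.const)
next
  case (add f g)
  then obtain f' g' where "f' \<in> flat_algebra" "g' \<in> flat_algebra"
    "\<And>x. (f has_real_derivative f' x) (at x)" "\<And>x. (g has_real_derivative g' x) (at x)" by blast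
  then show ?case
    by (intro bexI[of _ "\<lambda>x. f' x + g' x"]) (auto intro: flat_algebra.add DERIV_add)
next
  case (mult f g)
  then obtain f' g' where "f' \<in> flat_algebra" "g' \<in> flat_algebra"
    "\<And>x. (f has_real_derivative f' x) (at x)" "\<And>x. (g has_real_derivative g' x) (at x)" by blast
  with mult.hyps show ?case
    by (intro bexI[of _ "\<lambda>x. f' x * g x + g' x * f x"])
      (auto intro: flat_algebra.add flat_algebra.mult DERIV_mult)
qed

lemma flat_algebra_deriv:
  assumes "f \<in> flat_algebra"
  shows "deriv f \<in> flat_algebra" "(f has_real_derivative deriv f x) (at x)"
proof -
  obtain f' where f': "f' \<in> flat_algebra" "\<And>x. (f has_real_derivative f' x) (at x)"
    using flat_algebra_derivative[OF assms] by blast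
  then have "deriv f = f'" by (auto intro: DERIV_imp_deriv)
  with f' show "deriv f \<in> flat_algebra" "(f has_real_derivative deriv f x) (at x)" by auto
qed

lemma flat_algebra_higher_deriv: "f \<in> flat_algebra \<Longrightarrow> (deriv ^^ k) f \<in> flat_algebra"
  by (induction k) (auto intro: flat_algebra_deriv)

lemma flat_algebra_continuous: "f \<in> flat_algebra \<Longrightarrow> continuous_on S f"
  by (meson flat_algebra_deriv(2) DERIV_isCont continuous_at_imp_continuous_on)

text \<open>Membership is asked of \<open>deriv \<psi>\<close> because the test function needed for
  the constancy of functions with zero weak derivative is an antiderivative of a member of
  \<open>flat_algebra\<close>; such a function is smooth but need not lie in the algebra.\<close>

lemma test_function_if_deriv_flat_algebra:
  assumes "deriv \<psi> \<in> flat_algebra" and "\<And>x. (\<psi> has_real_derivative deriv \<psi> x) (at x)"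
    and "0 < a" "b < 1" and "\<And>x. x \<notin> {a..b} \<Longrightarrow> \<psi> x = 0"
  shows "test_function \<psi>"
  unfolding test_function_def
proof (intro conjI allI)
  fix k x
  show "(deriv ^^ k) \<psi> field_differentiable at x"
  proof (cases k)
    case 0
    then show ?thesis using assms(2) by (auto simp: field_differentiable_def)
  next
    case (Suc m)
    have "(deriv ^^ k) \<psi> = (deriv ^^ m) (deriv \<psi>)"
      by (simp add: Suc funpow_Suc_right del: funpow.simps)
    then show ?thesis
      using flat_algebra_deriv(2)[OF flat_algebra_higher_deriv[OF assms(1)]]
      by (auto simp: field_differentiable_def)
  qed
next
  show "\<exists>K. compact K \<and> K \<subseteq> {0<..<1} \<and> (\<forall>x. x \<notin> K \<longrightarrow> \<psi> x = 0)"
    using assms(3-5) by (intro exI[of _ "{a..b}"]) auto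
qed

text \<open>The factor \<open>n\<close> steepens the flanks without moving the support, so the bumps
  increase to the indicator of (a, b).\<close>

definition bump :: "nat \<Rightarrow> real \<Rightarrow> real \<Rightarrow> real \<Rightarrow> real" where
  "bump n a b x = flat 0 (of_nat n * (x - a)) * flat 0 (of_nat n * (b - x))"

lemma bump_flat_algebra: "bump n a b \<in> flat_algebra"
proof -
  have "(\<lambda>x. flat 0 (of_nat n * x + (- (of_nat n * a))) * flat 0 ((- of_nat n) * x + of_nat n * b))
      \<in> flat_algebra"
    by (intro flat_algebra.intros)
  also have "(\<lambda>x. flat 0 (of_nat n * x + (- (of_nat n * a))) * flat 0 ((- of_nat n) * x + of_nat n * b))
      = bump n a b"
    by (auto simp: bump_def algebra_simps)
  finally show ?thesis .
qed

lemma flat_0_bounds: "0 \<le> flat 0 x" "flat 0 x \<le> 1"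
  by (auto simp: flat_def)

lemma bump_bounds: "0 \<le> bump n a b x" "bump n a b x \<le> 1"
  by (auto simp: bump_def flat_0_bounds intro: mult_le_one)

lemma bump_eq_0: "x \<notin> {a<..<b} \<Longrightarrow> bump n a b x = 0"
  by (auto simp: bump_def flat_def zero_less_mult_iff)

lemma bump_pos: "n > 0 \<Longrightarrow> x \<in> {a<..<b} \<Longrightarrow> bump n a b x > 0"
  by (auto simp: bump_def flat_def)

lemma bump_tendsto: "(\<lambda>n. bump n a b x) \<longlonglongrightarrow> indicator {a<..<b} x"
proof (cases "x \<in> {a<..<b}")
  case True
  have f: "(\<lambda>n. flat 0 (of_nat n * c)) \<longlonglongrightarrow> 1" if "c > 0" for c
  proof (rule Lim_transform_eventually)
    have "(\<lambda>n. exp (- (inverse c * inverse (real n)))) \<longlonglongrightarrow> exp (- (inverse c * 0))"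
      by (intro tendsto_intros lim_inverse_n)
    then show "(\<lambda>n. exp (- (inverse c * inverse (real n)))) \<longlonglongrightarrow> 1" by simp
    show "\<forall>\<^sub>F n in sequentially. exp (- (inverse c * inverse (real n))) = flat 0 (of_nat n * c)"
      using that by (intro eventually_sequentiallyI[of 1]) (auto simp: flat_def field_simps)
  qed
  have "(\<lambda>n. bump n a b x) \<longlonglongrightarrow> 1 * 1"
    unfolding bump_def by (rule tendsto_mult) (use True in \<open>auto intro!: f\<close>)
  then show ?thesis using True by simp
qed (simp add: bump_eq_0)

lemma bump_test_function:
  assumes "0 < a" "b < 1" shows "test_function (bump n a b)"
proof (rule test_function_if_deriv_flat_algebra)
  show "deriv (bump n a b) \<in> flat_algebra"
    "(bump n a b has_real_derivative deriv (bump n a b) x) (at x)" for x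
    by (rule flat_algebra_deriv[OF bump_flat_algebra])+
  show "bump n a b x = 0" if "x \<notin> {a..b}" for x
    using that by (intro bump_eq_0) auto
qed fact+

section \<open>Weak derivatives on the unit interval\<close>

lemma prob_space_leb01: "prob_space leb01"
  by (rule prob_spaceI) (simp add: emeasure_restrict_space)

interpretation leb01: prob_space leb01
  by (rule prob_space_leb01)

interpretation leb01: pair_sigma_finite leb01 leb01
  by unfold_locales

lemma measure_leb01 [simp]: "measure leb01 {0<..<1} = 1"
  using leb01.prob_space by simp

lemma borel_measurable_leb01:
  "f \<in> borel_measurable borel \<Longrightarrow> f \<in> borel_measurable leb01"
  by (simp add: measurable_completion measurable_restrict_space1)

lemma id_measurable_leb01 [measurable]: "(\<lambda>x. x) \<in> leb01 \<rightarrow>\<^sub>M borel"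
  by (rule borel_measurable_leb01) simp

lemma continuous_measurable_leb01:
  "continuous_on UNIV f \<Longrightarrow> f \<in> borel_measurable leb01"
  by (intro borel_measurable_leb01 borel_measurable_continuous_onI)

lemma AE_leb01I: "(\<And>x. 0 < x \<Longrightarrow> x < 1 \<Longrightarrow> P x) \<Longrightarrow> AE x in leb01. P x"
  by (rule AE_I2) auto

lemma LINT_leb01_cong:
  "(\<And>x. 0 < x \<Longrightarrow> x < 1 \<Longrightarrow> f x = g x) \<Longrightarrow> (LINT x|leb01. f x) = (LINT x|leb01. g x)"
  by (rule Bochner_Integration.integral_cong) auto

text \<open>Bridge from the Bochner integral over \<open>leb01\<close> to the gauge integral over a
  compact interval, where the fundamental theorem of calculus and Lebesgue differentiation
  apply.\<close>

lemma LINT_leb01_subinterval: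
  fixes f :: "real \<Rightarrow> 'a::euclidean_space"
  assumes "integrable leb01 f" "0 \<le> a" "a \<le> b" "b \<le> 1"
  shows "(LINT t|leb01. (if a < t \<and> t < b then f t else 0)) = integral {a..b} f"
proof -
  have sub: "{a<..<b} \<subseteq> {0<..<1}" using assms by auto
  have "(LINT t|leb01. (if t \<in> {a<..<b} then f t else 0))
      = integral\<^sup>L (lebesgue_on ({a<..<b} \<inter> {0<..<1})) f"
    by (rule Lebesgue_Measure.integral_restrict_Int) auto
  also have "{a<..<b} \<inter> {0<..<1} = {a<..<b}" using sub by auto
  also have "integral\<^sup>L (lebesgue_on {a<..<b}) f = integral {a<..<b} f"
  proof (rule lebesgue_integral_eq_integral)
    have "set_integrable lebesgue {0<..<1} f"
      using assms(1) by (simp add: integrable_restrict_space set_integrable_def)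
    then have "set_integrable lebesgue {a<..<b} f"
      by (rule set_integrable_subset[OF _ _ sub]) auto
    then show "integrable (lebesgue_on {a<..<b}) f"
      by (simp add: integrable_restrict_space set_integrable_def)
  qed auto
  also have "\<dots> = integral {a..b} f" using integral_open_interval_real[of a b f] by simp
  finally show ?thesis by simp
qed

lemma integrable_leb01_continuous:
  fixes f :: "real \<Rightarrow> 'a::euclidean_space"
  assumes "continuous_on {0..1} f" shows "integrable leb01 f"
proof -
  have "set_integrable lebesgue {0..1} f"
    using assms by (rule absolutely_integrable_continuous_real)
  then have "set_integrable lebesgue {0<..<1} f"
    by (rule set_integrable_subset) auto
  then show ?thesis
    by (simp add: integrable_restrict_space set_integrable_def)
qed

lemma LINT_leb01_FTC:
  fixes f :: "real \<Rightarrow> 'a::euclidean_space"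
  assumes "0 \<le> a" "a \<le> b" "b \<le> 1" and "continuous_on {0..1} f"
    and "\<And>x. x \<in> {a..b} \<Longrightarrow> (F has_vector_derivative f x) (at x within {a..b})"
  shows "(LINT t|leb01. (if a < t \<and> t < b then f t else 0)) = F b - F a"
proof -
  have "integrable leb01 f"
    using assms(4) by (rule integrable_leb01_continuous)
  then show ?thesis
    using fundamental_theorem_of_calculus[OF assms(2) assms(5)] assms
    by (simp add: LINT_leb01_subinterval integral_unique)
qed

text \<open>Cutting off the integrand instead of the domain makes the primitive of an integrable
  function continuous on the whole line and constant outside (0, 1).\<close>

definition int_below :: "(real \<Rightarrow> complex) \<Rightarrow> real \<Rightarrow> complex" where
  "int_below g x = (LINT t|leb01. (if t < x then g t else 0))"

definition int_above :: "(real \<Rightarrow> complex) \<Rightarrow> real \<Rightarrow> complex" where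
  "int_above g x = (LINT t|leb01. (if x < t then g t else 0))"

lemma integrable_cut_below [simp, intro]:
  "integrable leb01 (g :: _ \<Rightarrow> complex) \<Longrightarrow> integrable leb01 (\<lambda>t. if t < x then g t else 0)"
  by (rule Bochner_Integration.integrable_bound[of _ g]) auto

lemma integrable_cut_above [simp, intro]:
  "integrable leb01 (g :: _ \<Rightarrow> complex) \<Longrightarrow> integrable leb01 (\<lambda>t. if x < t then g t else 0)"
  by (rule Bochner_Integration.integrable_bound[of _ g]) auto

text \<open>Fubini on the triangle t < x. Thus \<open>int_above\<close> is the transpose of
  \<open>int_below\<close>; this identity plays the role of integration by parts.\<close>

lemma LINT_int_below_mult:
  assumes [simp]: "integrable leb01 g" "integrable leb01 h"
  shows "(LINT x|leb01. int_below g x * h x) = (LINT x|leb01. g x * int_above h x)"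
proof -
  have [measurable]: "g \<in> borel_measurable leb01" "h \<in> borel_measurable leb01"
    by (auto intro: borel_measurable_integrable)
  define f where "f x t = (if t < x then g t else 0) * h x" for x t
  have m: "(\<lambda>(x, t). g t * h x) \<in> borel_measurable (leb01 \<Otimes>\<^sub>M leb01)"
    by measurable
  have [measurable]: "Measurable.pred (leb01 \<Otimes>\<^sub>M leb01) (\<lambda>p. snd p < fst p)"
    by measurable
  have m': "case_prod f \<in> borel_measurable (leb01 \<Otimes>\<^sub>M leb01)"
    unfolding f_def by measurable
  have "integrable (leb01 \<Otimes>\<^sub>M leb01) (\<lambda>(x, t). g t * h x)"
    by (rule leb01.Fubini_integrable[OF m]) (auto simp: norm_mult)
  then have i: "integrable (leb01 \<Otimes>\<^sub>M leb01) (case_prod f)"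
    by (rule Bochner_Integration.integrable_bound[OF _ m']) (auto simp: f_def)
  have "(LINT x|leb01. int_below g x * h x) = (LINT x|leb01. LINT t|leb01. f x t)"
    by (simp add: int_below_def f_def)
  also have "\<dots> = (LINT t|leb01. LINT x|leb01. f x t)"
    by (rule leb01.Fubini_integral[OF i, symmetric])
  also have "\<dots> = (LINT t|leb01. LINT x|leb01. g t * (if t < x then h x else 0))"
    by (intro Bochner_Integration.integral_cong) (auto simp: f_def)
  also have "\<dots> = (LINT x|leb01. g x * int_above h x)"
    by (simp add: int_above_def)
  finally show ?thesis .
qed

lemma int_below_bound:
  assumes "integrable leb01 g" shows "cmod (int_below g x) \<le> (LINT t|leb01. cmod (g t))"
  unfolding int_below_def
  by (rule order_trans[OF integral_norm_bound]) (auto intro!: integral_mono assms integrable_norm)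

lemma int_above_bound:
  assumes "integrable leb01 g" shows "cmod (int_above g x) \<le> (LINT t|leb01. cmod (g t))"
  unfolding int_above_def
  by (rule order_trans[OF integral_norm_bound]) (auto intro!: integral_mono assms integrable_norm)

lemma AE_leb01_neq: "AE t in leb01. t \<noteq> x"
proof -
  have "AE t in lborel. t \<noteq> x" by (rule AE_lborel_singleton)
  then have "AE t in lebesgue. t \<noteq> x" by (rule AE_completion)
  then show ?thesis by (subst AE_restrict_space_iff) auto
qed

lemma int_below_continuous:
  assumes [simp]: "integrable leb01 g" shows "continuous_on S (int_below g)"
proof (rule continuous_on_sequentiallyI)
  fix X :: "nat \<Rightarrow> real" and x assume X: "X \<longlonglongrightarrow> x"
  have [measurable]: "g \<in> borel_measurable leb01"
    by (auto intro: borel_measurable_integrable)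
  show "(\<lambda>n. int_below g (X n)) \<longlonglongrightarrow> int_below g x"
    unfolding int_below_def
  proof (rule integral_dominated_convergence[where w = "\<lambda>t. cmod (g t)"])
    \<comment> \<open>Pointwise convergence can fail only at t = x, which is a null set.\<close>
    show "AE t in leb01. (\<lambda>n. if t < X n then g t else 0) \<longlonglongrightarrow> (if t < x then g t else 0)"
      using AE_leb01_neq[of x]
    proof (rule AE_mp, intro AE_I2 impI)
      fix t assume "t \<noteq> x"
      then consider "t < x" | "x < t" by linarith
      then show "(\<lambda>n. if t < X n then g t else 0) \<longlonglongrightarrow> (if t < x then g t else 0)"
      proof cases
        case 1
        with order_tendstoD(1)[OF X 1] show ?thesis
          by (auto intro!: tendsto_eventually elim: eventually_mono)
      next
        case 2
        with order_tendstoD(2)[OF X 2] show ?thesis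
          by (auto intro!: tendsto_eventually elim: eventually_mono)
      qed
    qed
  qed auto
qed

lemma int_above_eq:
  assumes "integrable leb01 g"
  shows "int_above g x = (LINT t|leb01. g t) - int_below g x"
proof -
  have "int_above g x + int_below g x
      = (LINT t|leb01. (if x < t then g t else 0) + (if t < x then g t else 0))"
    unfolding int_above_def int_below_def by (intro Bochner_Integration.integral_add[symmetric]) (auto simp: assms)
  also have "\<dots> = (LINT t|leb01. g t)"
    using AE_leb01_neq[of x] by (intro integral_cong_AE)
      (auto intro!: borel_measurable_integrable Bochner_Integration.integrable_add assms elim!: AE_mp)
  finally show ?thesis by (simp add: algebra_simps)
qed

lemma int_above_continuous:
  assumes "integrable leb01 g" shows "continuous_on S (int_above g)"
proof -
  have "int_above g = (\<lambda>x. (LINT t|leb01. g t) - int_below g x)"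
    using assms by (auto simp: int_above_eq)
  then show ?thesis using assms by (auto intro!: continuous_intros int_below_continuous)
qed

lemma integrable_int_below [simp, intro]: "integrable leb01 g \<Longrightarrow> integrable leb01 (int_below g)"
  by (rule integrable_leb01_continuous[OF int_below_continuous])

lemma integrable_int_above [simp, intro]: "integrable leb01 g \<Longrightarrow> integrable leb01 (int_above g)"
  by (rule integrable_leb01_continuous[OF int_above_continuous])

text \<open>Fundamental lemma of the calculus of variations: as n grows the bumps turn into
  indicators, so \<open>f\<close> has integral 0 over every compact subinterval, and Lebesgue
  differentiation recovers \<open>f\<close> almost everywhere from these integrals.\<close>

lemma AE_eq_0_if_bump_orthogonal:
  fixes f :: "real \<Rightarrow> complex"
  assumes f: "integrable leb01 f"
    and orth: "\<And>n a b. 0 < a \<Longrightarrow> a < b \<Longrightarrow> b < 1 \<Longrightarrow> (LINT x|leb01. f x * of_real (bump n a b x)) = 0"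
  shows "AE x in leb01. f x = 0"
proof -
  have [measurable]: "f \<in> borel_measurable leb01"
    using f by (rule borel_measurable_integrable)
  have [measurable]: "bump n a b \<in> borel_measurable leb01" for n a b
    by (intro continuous_measurable_leb01 flat_algebra_continuous bump_flat_algebra)
  have interval_0: "integral {a..b} f = 0" if ab: "0 < a" "a < b" "b < 1" for a b
  proof -
    have "(\<lambda>n. LINT x|leb01. f x * of_real (bump n a b x))
        \<longlonglongrightarrow> (LINT x|leb01. f x * of_real (indicator {a<..<b} x))"
    proof (rule integral_dominated_convergence[where w = "\<lambda>x. cmod (f x)"])
      show "AE x in leb01. (\<lambda>n. f x * complex_of_real (bump n a b x))
          \<longlonglongrightarrow> f x * complex_of_real (indicat_real {a<..<b} x)"
        by (intro AE_I2 tendsto_intros bump_tendsto)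
      show "AE x in leb01. cmod (f x * complex_of_real (bump n a b x)) \<le> cmod (f x)" for n
        by (intro AE_I2) (auto simp: norm_mult bump_bounds intro!: mult_left_le)
    qed (use f in auto)
    then have "(LINT x|leb01. f x * of_real (indicator {a<..<b} x)) = 0"
      using orth[OF ab] by (simp add: LIMSEQ_const_iff)
    also have "(LINT x|leb01. f x * of_real (indicator {a<..<b} x))
        = (LINT x|leb01. (if a < x \<and> x < b then f x else 0))"
      by (rule LINT_leb01_cong) (auto simp: indicator_def)
    also have "\<dots> = integral {a..b} f"
      using f ab by (intro LINT_leb01_subinterval) auto
    finally show ?thesis .
  qed
  \<comment> \<open>Extension by 0, because the differentiation theorem concerns functions on the
    whole line.\<close>
  define F where "F x = (if x \<in> {0<..<1} then f x else 0)" for x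
  have "integrable lebesgue F"
    unfolding F_def using f by (subst Lebesgue_Measure.integrable_restrict_UNIV) auto
  then have "F absolutely_integrable_on UNIV"
    by (simp add: set_integrable_def)
  then have "F integrable_on cbox a b" for a b
    by (meson absolutely_integrable_on_def integrable_on_subcbox top_greatest)
  then obtain N where N: "negligible N"
    "\<And>x e. \<lbrakk>x \<notin> N; 0 < e\<rbrakk> \<Longrightarrow> \<exists>d>0. \<forall>h. 0 < h \<and> h < d \<longrightarrow>
        norm (integral (cbox x (x + h *\<^sub>R One)) F /\<^sub>R h ^ DIM(real) - F x) < e"
    by (rule integrable_ccontinuous_explicit) blast
  have "f x = 0" if x: "x \<notin> N" "0 < x" "x < 1" for x
  proof (rule ccontr)
    assume "f x \<noteq> 0"
    then obtain d where d: "d > 0" "\<And>h. 0 < h \<and> h < d \<Longrightarrow>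
        norm (integral (cbox x (x + h *\<^sub>R One)) F /\<^sub>R h ^ DIM(real) - F x) < cmod (f x)"
      using N(2)[OF x(1), of "cmod (f x)"] by auto
    \<comment> \<open>This \<open>h\<close> is below \<open>d\<close> and keeps [x, x + h] inside
      (0, 1); the mean over that interval is 0, which would give |f x| < |f x|.\<close>
    define h where "h = min (d / 2) ((1 - x) / 2)"
    have h: "0 < h" "h < d" "x + h < 1" using d(1) x by (auto simp: h_def min_def field_simps)
    have "integral {x..x + h} F = integral {x..x + h} f"
      by (rule integral_cong) (use x h in \<open>auto simp: F_def\<close>)
    then show False
      using d(2)[of h] h x interval_0[of x "x + h"] by (simp add: F_def)
  qed
  moreover have "AE x in lebesgue. x \<notin> N"
    using N(1) by (simp add: negligible_iff_null_sets AE_not_in)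
  ultimately show ?thesis
    by (subst AE_restrict_space_iff) auto
qed

text \<open>The condition of \<open>has_weak_deriv\<close> on functions instead of classes, so that
  explicit formulas can be treated without passing through \<open>rep_l2\<close>.\<close>

definition weakly_diff :: "(real \<Rightarrow> complex) \<Rightarrow> (real \<Rightarrow> complex) \<Rightarrow> bool" where
  "weakly_diff f g \<longleftrightarrow> (\<forall>\<psi>. test_function \<psi> \<longrightarrow>
     (LINT x|leb01. f x * of_real (deriv \<psi> x)) = - (LINT x|leb01. g x * of_real (\<psi> x)))"

lemma test_function_props:
  assumes "test_function \<psi>"
  shows "(\<psi> has_real_derivative deriv \<psi> x) (at x)"
    and "continuous_on S \<psi>" and "continuous_on S (deriv \<psi>)"
    and "x \<le> 0 \<Longrightarrow> \<psi> x = 0" and "x \<ge> 1 \<Longrightarrow> \<psi> x = 0"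
proof -
  have d: "(deriv ^^ k) \<psi> field_differentiable (at x)" for k x
    using assms by (auto simp: test_function_def)
  show "(\<psi> has_real_derivative deriv \<psi> x) (at x)"
    using d[of 0] by (simp add: field_differentiable_derivI DERIV_deriv_iff_field_differentiable)
  show "continuous_on S \<psi>"
    using d[of 0] by (auto intro!: continuous_at_imp_continuous_on field_differentiable_imp_continuous_at)
  show "continuous_on S (deriv \<psi>)"
    using d[of 1] by (auto intro!: continuous_at_imp_continuous_on field_differentiable_imp_continuous_at)
  show "x \<le> 0 \<Longrightarrow> \<psi> x = 0" and "x \<ge> 1 \<Longrightarrow> \<psi> x = 0"
    using assms by (auto simp: test_function_def subset_iff dest!: spec[of _ x])
qed

lemma integrable_mult_continuous:
  fixes f g :: "real \<Rightarrow> complex"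
  assumes "integrable leb01 f" and "continuous_on {0..1} g"
  shows "integrable leb01 (\<lambda>x. f x * g x)" "integrable leb01 (\<lambda>x. g x * f x)"
proof -
  have [measurable]: "f \<in> borel_measurable leb01" "g \<in> borel_measurable leb01"
    using assms by (auto intro!: borel_measurable_integrable integrable_leb01_continuous)
  have "compact (g ` {0..1})" using assms by (intro compact_continuous_image) auto
  then obtain B where B: "\<And>x. x \<in> {0..1} \<Longrightarrow> cmod (g x) \<le> B"
    by (meson bounded_iff compact_imp_bounded image_eqI)
  show "integrable leb01 (\<lambda>x. f x * g x)"
    by (rule Bochner_Integration.integrable_bound[where f = "\<lambda>x. B * cmod (f x)"])
      (use assms B in \<open>auto intro!: AE_leb01I mult_left_mono order_trans[OF _ abs_ge_self]
         simp: norm_mult abs_mult mult.commute[of "\<bar>B\<bar>"]\<close>)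
  then show "integrable leb01 (\<lambda>x. g x * f x)" by (simp add: mult.commute)
qed

text \<open>Transposition moves the primitive onto \<open>deriv \<psi>\<close>, and
  \<open>int_above\<close> of \<open>deriv \<psi>\<close> is -\<psi> on (0, 1) because \<psi>
  vanishes at 1.\<close>

lemma weakly_diff_int_below:
  assumes [simp]: "integrable leb01 g" shows "weakly_diff (int_below g) g"
  unfolding weakly_diff_def
proof (intro allI impI)
  fix \<psi> assume \<psi>: "test_function \<psi>"
  have cont: "continuous_on S (\<lambda>x. complex_of_real (deriv \<psi> x))" for S
    using test_function_props(3)[OF \<psi>] by (intro continuous_intros)
  have above: "int_above (\<lambda>x. of_real (deriv \<psi> x)) t = - of_real (\<psi> t)" if t: "0 < t" "t < 1" for t
  proof -
    have "int_above (\<lambda>x. of_real (deriv \<psi> x)) t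
        = (LINT x|leb01. (if t < x \<and> x < 1 then complex_of_real (deriv \<psi> x) else 0))"
      unfolding int_above_def by (rule LINT_leb01_cong) auto
    also have "\<dots> = of_real (\<psi> 1) - of_real (\<psi> t)"
    proof (rule LINT_leb01_FTC)
      show "((\<lambda>x. complex_of_real (\<psi> x)) has_vector_derivative complex_of_real (deriv \<psi> x))
          (at x within {t..1})" for x
        using test_function_props(1)[OF \<psi>]
        by (intro has_vector_derivative_of_real has_vector_derivative_at_within)
          (simp add: has_real_derivative_iff_has_vector_derivative)
    qed (use t cont in auto)
    finally show ?thesis using test_function_props(5)[OF \<psi>, of 1] by simp
  qed
  have "(LINT x|leb01. int_below g x * of_real (deriv \<psi> x))
      = (LINT t|leb01. g t * int_above (\<lambda>x. of_real (deriv \<psi> x)) t)"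
    using integrable_leb01_continuous[OF cont] by (intro LINT_int_below_mult) auto
  also have "\<dots> = (LINT t|leb01. - (g t * of_real (\<psi> t)))"
    by (rule LINT_leb01_cong) (simp add: above)
  finally show "(LINT x|leb01. int_below g x * of_real (deriv \<psi> x))
      = - (LINT t|leb01. g t * of_real (\<psi> t))" by simp
qed

lemma weakly_diff_unique:
  assumes "weakly_diff f g" "weakly_diff f h" and [simp]: "integrable leb01 g" "integrable leb01 h"
  shows "AE x in leb01. g x = h x"
proof -
  have "AE x in leb01. g x - h x = 0"
  proof (rule AE_eq_0_if_bump_orthogonal)
    fix n and a b :: real assume ab: "0 < a" "a < b" "b < 1"
    have cont: "continuous_on {0..1} (\<lambda>x. complex_of_real (bump n a b x))"
      by (intro continuous_intros flat_algebra_continuous bump_flat_algebra)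
    have "(LINT x|leb01. g x * of_real (bump n a b x)) = (LINT x|leb01. h x * of_real (bump n a b x))"
      using assms(1,2)[unfolded weakly_diff_def, rule_format, OF bump_test_function[OF ab(1,3), of n]]
      by simp
    then show "(LINT x|leb01. (g x - h x) * of_real (bump n a b x)) = 0"
      using integrable_mult_continuous(1)[OF assms(3) cont] integrable_mult_continuous(1)[OF assms(4) cont]
      by (simp add: left_diff_distrib)
  qed auto
  then show ?thesis by eventually_elim simp
qed

lemma ex_antiderivative:
  fixes f :: "real \<Rightarrow> real"
  assumes "continuous_on UNIV f"
  shows "\<exists>F. \<forall>x. (F has_real_derivative f x) (at x)"
proof -
  have "isCont f x" for x
    using assms by (simp add: continuous_on_eq_continuous_at)
  then have "\<exists>F. \<forall>x::real. -\<infinity> < ereal x \<longrightarrow> ereal x < \<infinity> \<longrightarrow> (F has_vector_derivative f x) (at x)"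
    by (intro einterval_antiderivative) auto
  then show ?thesis
    by (simp add: has_real_derivative_iff_has_vector_derivative)
qed

text \<open>Du Bois-Reymond: a bump minus the multiple of a fixed bump \<open>\<eta>\<close> that
  makes its mean 0 is the derivative of a test function, hence orthogonal to \<open>f\<close>. So
  \<open>f\<close> minus its \<open>\<eta>\<close>-weighted mean is orthogonal to every
  bump.\<close>

lemma weakly_diff_0_imp_const:
  assumes "weakly_diff f (\<lambda>_. 0)" and [simp]: "integrable leb01 f"
  shows "\<exists>c. AE x in leb01. f x = c"
proof -
  define \<eta> where "\<eta> = bump 1 (1/4) (3/4)"
  have \<eta>: "\<eta> \<in> flat_algebra" by (simp add: \<eta>_def bump_flat_algebra)
  define Z where "Z = (LINT x|leb01. \<eta> x)"
  have "Z \<noteq> 0"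
  proof
    assume "Z = 0"
    then have "AE x in leb01. \<eta> x = 0"
      unfolding Z_def using flat_algebra_continuous[OF \<eta>]
      by (subst (asm) integral_nonneg_eq_0_iff_AE)
        (auto simp: \<eta>_def bump_bounds intro!: integrable_leb01_continuous)
    then have "AE x in lebesgue. x \<in> {0<..<1} \<longrightarrow> \<eta> x = 0"
      by (subst (asm) AE_restrict_space_iff) auto
    then have "AE x in lebesgue. x \<notin> {1/4<..<3/4::real}"
    proof eventually_elim
      case (elim x)
      then show ?case using bump_pos[of 1 x "1/4" "3/4"] by (auto simp: \<eta>_def)
    qed
    then have "emeasure lebesgue {1/4<..<3/4::real} = 0"
      by (subst (asm) AE_iff_measurable[of "{1/4<..<3/4}"]) (auto simp del: emeasure_completion)
    then show False by simp
  qed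
  define c where "c = (LINT x|leb01. f x * of_real (\<eta> x)) / of_real Z"
  have "AE x in leb01. f x - c = 0"
  proof (rule AE_eq_0_if_bump_orthogonal)
    fix n and a b :: real assume ab: "0 < a" "a < b" "b < 1"
    define \<beta> where "\<beta> = bump n a b"
    have \<beta>: "\<beta> \<in> flat_algebra" by (simp add: \<beta>_def bump_flat_algebra)
    have cont: "continuous_on S (\<lambda>x. complex_of_real (\<beta> x))" "continuous_on S (\<lambda>x. complex_of_real (\<eta> x))"
      "continuous_on S \<beta>" "continuous_on S \<eta>" for S
      using \<beta> \<eta> by (auto intro!: continuous_intros flat_algebra_continuous)
    \<comment> \<open>Chosen so that \<open>\<rho>\<close> has integral 0; then the antiderivative
      of \<open>\<rho>\<close> vanishing at 0 also vanishes at 1, hence everywhere outside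
      [lo, hi].\<close>
    define \<kappa> where "\<kappa> = (LINT x|leb01. \<beta> x) / Z"
    define \<rho> where "\<rho> x = \<beta> x + (- \<kappa>) * \<eta> x" for x
    have \<rho>: "\<rho> \<in> flat_algebra"
      unfolding \<rho>_def using \<beta> \<eta> by (intro flat_algebra.intros)
    obtain F where F: "\<And>x. (F has_real_derivative \<rho> x) (at x)"
      using ex_antiderivative[OF flat_algebra_continuous[OF \<rho>]] by blast
    define \<psi> where "\<psi> x = F x - F 0" for x
    have d\<psi>: "(\<psi> has_real_derivative \<rho> x) (at x)" for x
      unfolding \<psi>_def by (auto intro!: derivative_eq_intros F)
    then have deriv\<psi>: "deriv \<psi> = \<rho>" by (auto intro: DERIV_imp_deriv)
    define lo where "lo = min a (1/4)"
    define hi where "hi = max b (3/4)"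
    have lohi: "0 < lo" "lo < hi" "hi < 1" using ab by (auto simp: lo_def hi_def)
    have \<rho>0: "\<rho> x = 0" if "x \<notin> {lo<..<hi}" for x
    proof -
      have "\<beta> x = 0" "\<eta> x = 0"
        unfolding \<beta>_def \<eta>_def using that by (intro bump_eq_0; force simp: lo_def hi_def)+
      then show ?thesis by (simp add: \<rho>_def)
    qed
    have "(LINT x|leb01. (if 0 < x \<and> x < 1 then \<rho> x else 0)) = F 1 - F 0"
      using F flat_algebra_continuous[OF \<rho>]
      by (intro LINT_leb01_FTC)
        (auto simp: has_real_derivative_iff_has_vector_derivative intro: has_vector_derivative_at_within)
    also have "(LINT x|leb01. (if 0 < x \<and> x < 1 then \<rho> x else 0)) = (LINT x|leb01. \<rho> x)"
      by (rule LINT_leb01_cong) auto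
    also have "\<dots> = (LINT x|leb01. \<beta> x) - \<kappa> * Z"
      unfolding \<rho>_def Z_def using cont
      by (subst Bochner_Integration.integral_add) (auto intro!: integrable_leb01_continuous)
    also have "\<dots> = 0" using \<open>Z \<noteq> 0\<close> by (simp add: \<kappa>_def)
    finally have F10: "F 1 = F 0" by simp
    have const: "\<psi> x = \<psi> y" if "x < y" "\<And>z. z \<in> {x<..<y} \<Longrightarrow> \<rho> z = 0" for x y
    proof (rule DERIV_isconst_end[where f = \<psi> and a = x and b = y, symmetric])
      show "continuous_on {x..y} \<psi>"
        using d\<psi> by (meson DERIV_isCont continuous_at_imp_continuous_on)
      show "(\<psi> has_real_derivative 0) (at z)" if "x < z" "z < y" for z
        using d\<psi>[of z] that \<open>\<And>z. z \<in> {x<..<y} \<Longrightarrow> \<rho> z = 0\<close>[of z] by simp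
    qed fact
    have const': "\<psi> x = \<psi> y" if "\<And>z. z \<in> {min x y<..<max x y} \<Longrightarrow> \<rho> z = 0" for x y
    proof (cases x y rule: linorder_cases)
      case less
      then show ?thesis using that by (intro const) auto
    next
      case greater
      then show ?thesis using that by (intro const[symmetric]) auto
    qed simp
    have "test_function \<psi>"
    proof (rule test_function_if_deriv_flat_algebra[OF _ _ lohi(1,3)])
      fix x assume x: "x \<notin> {lo..hi}"
      show "\<psi> x = 0"
      proof (cases "x < lo")
        case True
        then have "\<psi> x = \<psi> 0"
          using lohi by (intro const' \<rho>0) auto
        then show ?thesis by (simp add: \<psi>_def)
      next
        case False
        then have "\<psi> x = \<psi> 1"
          using lohi x by (intro const' \<rho>0) auto
        then show ?thesis by (simp add: \<psi>_def F10)
      qed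
    qed (use \<rho> d\<psi> in \<open>auto simp: deriv\<psi>\<close>)
    then have "(LINT x|leb01. f x * of_real (\<rho> x)) = 0"
      using assms(1) by (auto simp: weakly_diff_def deriv\<psi>)
    also have "(LINT x|leb01. f x * of_real (\<rho> x))
        = (LINT x|leb01. f x * of_real (\<beta> x) - of_real \<kappa> * (f x * of_real (\<eta> x)))"
      by (rule LINT_leb01_cong) (simp add: \<rho>_def algebra_simps)
    also have "\<dots> = (LINT x|leb01. f x * of_real (\<beta> x)) - of_real \<kappa> * (LINT x|leb01. f x * of_real (\<eta> x))"
      using integrable_mult_continuous(1)[OF assms(2) cont(1)] integrable_mult_continuous(1)[OF assms(2) cont(2)]
      by (subst Bochner_Integration.integral_diff) simp_all
    also have "of_real \<kappa> * (LINT x|leb01. f x * of_real (\<eta> x)) = (LINT x|leb01. c * of_real (\<beta> x))"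
      by (simp add: c_def \<kappa>_def)
    also have "(LINT x|leb01. f x * of_real (\<beta> x)) - (LINT x|leb01. c * of_real (\<beta> x))
        = (LINT x|leb01. (f x - c) * of_real (\<beta> x))"
      unfolding left_diff_distrib
      by (rule Bochner_Integration.integral_diff[symmetric])
        (intro integrable_mult_continuous(1) integrable_leb01_continuous continuous_on_mult_left cont assms(2))+
    finally show "(LINT x|leb01. (f x - c) * of_real (bump n a b x)) = 0" by (simp add: \<beta>_def)
  qed auto
  then have "AE x in leb01. f x = c" by eventually_elim simp
  then show ?thesis by blast
qed

text \<open>Subtracting the primitive of \<open>g\<close> leaves a function with weak derivative
  0.\<close>

lemma weakly_diff_imp_int_below:
  assumes "weakly_diff f g" and [simp]: "integrable leb01 f" "integrable leb01 g"
  shows "\<exists>c. AE x in leb01. f x = c + int_below g x"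
proof -
  have "weakly_diff (\<lambda>x. f x - int_below g x) (\<lambda>_. 0)"
    unfolding weakly_diff_def
  proof (intro allI impI)
    fix \<psi> assume \<psi>: "test_function \<psi>"
    have "continuous_on {0..1} (\<lambda>x. complex_of_real (deriv \<psi> x))"
      using test_function_props(3)[OF \<psi>] by (intro continuous_intros)
    then show "(LINT x|leb01. (f x - int_below g x) * of_real (deriv \<psi> x))
        = - (LINT x|leb01. 0 * of_real (\<psi> x))"
      using assms(1) weakly_diff_int_below[of g] \<psi>
      by (simp add: left_diff_distrib integrable_mult_continuous weakly_diff_def)
  qed
  then obtain c where "AE x in leb01. f x - int_below g x = c"
    using weakly_diff_0_imp_const[of "\<lambda>x. f x - int_below g x"] by auto
  then have "AE x in leb01. f x = c + int_below g x"
    by eventually_elim (simp add: algebra_simps)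
  then show ?thesis by blast
qed

section \<open>Square integrable functions and the space H2\<close>

lemma square_integrableD:
  assumes "square_integrable f"
  shows "f \<in> borel_measurable leb01" "integrable leb01 (\<lambda>x. (cmod (f x))\<^sup>2)" "integrable leb01 f"
proof -
  show f: "f \<in> borel_measurable leb01" and i: "integrable leb01 (\<lambda>x. (cmod (f x))\<^sup>2)"
    using assms by (auto simp: square_integrable_def)
  show "integrable leb01 f"
  proof (rule Bochner_Integration.integrable_bound[where f = "\<lambda>x. 1 + (cmod (f x))\<^sup>2"])
    show "AE x in leb01. cmod (f x) \<le> norm (1 + (cmod (f x))\<^sup>2)"
    proof (rule AE_I2)
      fix x
      have "0 \<le> (cmod (f x) - 1)\<^sup>2 + (cmod (f x))\<^sup>2 + 1" by simp
      then have "2 * cmod (f x) \<le> 2 + 2 * (cmod (f x))\<^sup>2" by (simp add: power2_eq_square algebra_simps)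
      then show "cmod (f x) \<le> norm (1 + (cmod (f x))\<^sup>2)" by simp
    qed
  qed (use f i in auto)
qed

lemma square_integrable_cnj:
  assumes "square_integrable f" shows "square_integrable (\<lambda>x. cnj (f x))"
proof -
  have "cnj \<in> borel_measurable borel"
    by (intro borel_measurable_continuous_onI continuous_intros)
  then have "(\<lambda>x. cnj (f x)) \<in> borel_measurable leb01"
    using assms by (intro measurable_compose[OF square_integrableD(1)])
  then show ?thesis using assms by (simp add: square_integrable_def)
qed

lemma square_integrable_mult_integrable:
  assumes "square_integrable f" "square_integrable g"
  shows "integrable leb01 (\<lambda>x. f x * g x)"
proof (rule Bochner_Integration.integrable_bound[where f = "\<lambda>x. (cmod (f x))\<^sup>2 + (cmod (g x))\<^sup>2"])
  show "AE x in leb01. cmod (f x * g x) \<le> norm ((cmod (f x))\<^sup>2 + (cmod (g x))\<^sup>2)"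
  proof (rule AE_I2)
    fix x
    have "0 \<le> (cmod (f x) - cmod (g x))\<^sup>2 + (cmod (f x))\<^sup>2 + (cmod (g x))\<^sup>2" by simp
    then show "cmod (f x * g x) \<le> norm ((cmod (f x))\<^sup>2 + (cmod (g x))\<^sup>2)"
      by (simp add: power2_eq_square algebra_simps norm_mult)
  qed
qed (use assms[THEN square_integrableD(1)] assms[THEN square_integrableD(2)] in auto)

lemma square_integrable_bounded_mult:
  assumes "square_integrable f" and [measurable]: "h \<in> borel_measurable leb01"
    and B: "AE x in leb01. cmod (h x) \<le> B"
  shows "square_integrable (\<lambda>x. h x * f x)"
  unfolding square_integrable_def
proof
  have [measurable]: "f \<in> borel_measurable leb01"
    using assms(1) by (rule square_integrableD)
  show "(\<lambda>x. h x * f x) \<in> borel_measurable leb01" by measurable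
  show "integrable leb01 (\<lambda>x. (cmod (h x * f x))\<^sup>2)"
  proof (rule Bochner_Integration.integrable_bound[where f = "\<lambda>x. B\<^sup>2 * (cmod (f x))\<^sup>2"])
    show "AE x in leb01. norm ((cmod (h x * f x))\<^sup>2) \<le> norm (B\<^sup>2 * (cmod (f x))\<^sup>2)"
      using B
    proof eventually_elim
      case (elim x)
      then have "(cmod (h x))\<^sup>2 \<le> B\<^sup>2" by (intro power_mono) auto
      then show ?case by (simp add: norm_mult power_mult_distrib mult_right_mono)
    qed
  qed (use square_integrableD(2)[OF assms(1)] in auto)
qed

lemma square_integrable_add:
  assumes "square_integrable f" "square_integrable g"
  shows "square_integrable (\<lambda>x. f x + g x)"
  unfolding square_integrable_def
proof
  have [measurable]: "f \<in> borel_measurable leb01" "g \<in> borel_measurable leb01"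
    using assms by (auto intro: square_integrableD)
  show "(\<lambda>x. f x + g x) \<in> borel_measurable leb01" by measurable
  show "integrable leb01 (\<lambda>x. (cmod (f x + g x))\<^sup>2)"
  proof (rule Bochner_Integration.integrable_bound[where f = "\<lambda>x. 2 * ((cmod (f x))\<^sup>2 + (cmod (g x))\<^sup>2)"])
    show "AE x in leb01. norm ((cmod (f x + g x))\<^sup>2) \<le> norm (2 * ((cmod (f x))\<^sup>2 + (cmod (g x))\<^sup>2))"
    proof (rule AE_I2)
      fix x
      have "(cmod (f x + g x))\<^sup>2 \<le> (cmod (f x) + cmod (g x))\<^sup>2"
        by (intro power_mono norm_triangle_ineq) auto
      also have "\<dots> \<le> 2 * ((cmod (f x))\<^sup>2 + (cmod (g x))\<^sup>2)"
        using zero_le_power2[of "cmod (f x) - cmod (g x)"] by (simp add: power2_eq_square algebra_simps)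
      finally show "norm ((cmod (f x + g x))\<^sup>2) \<le> norm (2 * ((cmod (f x))\<^sup>2 + (cmod (g x))\<^sup>2))" by simp
    qed
  qed (use assms[THEN square_integrableD(2)] in auto)
qed

lemma square_integrable_bounded:
  assumes "h \<in> borel_measurable leb01" "AE x in leb01. cmod (h x) \<le> B"
  shows "square_integrable h"
proof -
  have "square_integrable (\<lambda>x. 1)" by (simp add: square_integrable_def)
  then show ?thesis using square_integrable_bounded_mult[OF _ assms, of "\<lambda>x. 1"] by simp
qed

lemma square_integrable_continuous:
  assumes "continuous_on UNIV f" shows "square_integrable f"
proof -
  have "bounded (f ` {0..1})"
    using assms by (intro compact_imp_bounded compact_continuous_image) (auto intro: continuous_on_subset)
  then obtain B where "\<And>x. x \<in> {0..1} \<Longrightarrow> cmod (f x) \<le> B" by (meson bounded_iff image_eqI)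
  then show ?thesis
    using assms by (intro square_integrable_bounded[of f B] continuous_measurable_leb01 AE_leb01I) auto
qed

text \<open>The variance of |f| on the probability space \<open>leb01\<close> is
  nonnegative.\<close>

lemma L1_le_L2_norm:
  assumes "square_integrable f"
  shows "(LINT x|leb01. cmod (f x)) \<le> sqrt (LINT x|leb01. (cmod (f x))\<^sup>2)"
proof -
  define m where "m = (LINT x|leb01. cmod (f x))"
  have [simp]: "integrable leb01 (\<lambda>x. cmod (f x))" "integrable leb01 (\<lambda>x. (cmod (f x))\<^sup>2)"
    using assms by (auto intro: square_integrableD)
  have "0 \<le> (LINT x|leb01. (cmod (f x) - m)\<^sup>2)" by simp
  also have "\<dots> = (LINT x|leb01. (cmod (f x))\<^sup>2 - (2 * m * cmod (f x) - m\<^sup>2))"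
    by (simp add: power2_eq_square algebra_simps)
  also have "\<dots> = (LINT x|leb01. (cmod (f x))\<^sup>2) - m\<^sup>2"
    by (subst Bochner_Integration.integral_diff, simp, simp, subst Bochner_Integration.integral_diff)
      (simp_all add: m_def[symmetric] leb01.prob_space power2_eq_square)
  finally show ?thesis unfolding m_def[symmetric] by (intro real_le_rsqrt) simp
qed

section \<open>Passage between almost-everywhere classes and representatives\<close>

lemma square_integrable_rep_l2 [simp]: "square_integrable (rep_l2 u)"
proof -
  have "l2_eq (rep_l2 u) (rep_l2 u)" by (simp add: Quotient_rep_reflp[OF Quotient_l2])
  then show ?thesis by (simp add: l2_eq_def)
qed

lemma integrable_rep_l2 [simp]: "integrable leb01 (rep_l2 u)"
  by (rule square_integrableD) simp

lemma AE_rep_abs_l2: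
  assumes "square_integrable f"
  shows "AE x in leb01. rep_l2 (abs_l2 f) x = f x"
proof -
  have "l2_eq f f" using assms by (simp add: l2_eq_def)
  then have "l2_eq (rep_l2 (abs_l2 f)) f" by (rule Quotient_rep_abs[OF Quotient_l2])
  then show ?thesis by (simp add: l2_eq_def)
qed

lemma l2_eqI: "AE x in leb01. rep_l2 u x = rep_l2 v x \<Longrightarrow> u = v"
  by (rule Quotient_rel_rep[OF Quotient_l2, THEN iffD1]) (simp add: l2_eq_def)

lemma AE_rep_zero_l2: "AE x in leb01. rep_l2 0 x = 0"
proof -
  have "0 = abs_l2 (\<lambda>x. 0)" by (simp add: zero_l2_def)
  then show ?thesis using AE_rep_abs_l2[of "\<lambda>x. 0"] by (simp add: square_integrable_def)
qed

lemma has_weak_deriv_iff: "has_weak_deriv u v \<longleftrightarrow> weakly_diff (rep_l2 u) (rep_l2 v)"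
  by (simp add: has_weak_deriv_def weakly_diff_def)

text \<open>Uniqueness of weak derivatives is what gives the definite description in
  \<open>weak_deriv\<close> its value.\<close>

lemma weak_deriv_eq:
  assumes "has_weak_deriv u v" shows "weak_deriv u = v"
  unfolding weak_deriv_def
proof (rule the_equality)
  show "w = v" if "has_weak_deriv u w" for w
    using that assms by (intro l2_eqI weakly_diff_unique[of "rep_l2 u"]) (auto simp: has_weak_deriv_iff)
qed fact

lemma weakly_diff_cong:
  assumes "AE x in leb01. f x = f' x" "AE x in leb01. g x = g' x" "weakly_diff f g"
    and [measurable]: "f \<in> borel_measurable leb01" "f' \<in> borel_measurable leb01"
      "g \<in> borel_measurable leb01" "g' \<in> borel_measurable leb01"
  shows "weakly_diff f' g'"
  unfolding weakly_diff_def
proof (intro allI impI)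
  fix \<psi> assume \<psi>: "test_function \<psi>"
  have [measurable]: "\<psi> \<in> borel_measurable leb01" "deriv \<psi> \<in> borel_measurable leb01"
    using test_function_props(2,3)[OF \<psi>] by (auto intro: continuous_measurable_leb01)
  have "(LINT x|leb01. f' x * of_real (deriv \<psi> x)) = (LINT x|leb01. f x * of_real (deriv \<psi> x))"
    by (intro integral_cong_AE; (measurable; fail)?) (use assms(1) in eventually_elim, simp)
  moreover have "(LINT x|leb01. g' x * of_real (\<psi> x)) = (LINT x|leb01. g x * of_real (\<psi> x))"
    by (intro integral_cong_AE; (measurable; fail)?) (use assms(2) in eventually_elim, simp)
  ultimately show "(LINT x|leb01. f' x * of_real (deriv \<psi> x)) = - (LINT x|leb01. g' x * of_real (\<psi> x))"
    using assms(3) \<psi> by (simp add: weakly_diff_def)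
qed

text \<open>A test function vanishes at both end points, so its derivative has integral 0 and
  constants contribute nothing.\<close>

lemma weakly_diff_add_const:
  assumes "weakly_diff f g" and f: "integrable leb01 f"
  shows "weakly_diff (\<lambda>x. c + f x) g"
  unfolding weakly_diff_def
proof (intro allI impI)
  fix \<psi> assume \<psi>: "test_function \<psi>"
  have cont: "continuous_on {0..1} (\<lambda>x. complex_of_real (deriv \<psi> x))"
    using test_function_props(3)[OF \<psi>] by (intro continuous_intros)
  have "(LINT x|leb01. deriv \<psi> x) = (LINT x|leb01. (if 0 < x \<and> x < 1 then deriv \<psi> x else 0))"
    by (rule LINT_leb01_cong) auto
  also have "\<dots> = \<psi> 1 - \<psi> 0"
  proof (rule LINT_leb01_FTC)
    show "(\<psi> has_vector_derivative deriv \<psi> x) (at x within {0..1})" for x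
      using test_function_props(1)[OF \<psi>, of x]
      by (simp add: has_real_derivative_iff_has_vector_derivative has_vector_derivative_at_within)
  qed (use test_function_props(3)[OF \<psi>] in simp_all)
  also have "\<dots> = 0" using test_function_props(4,5)[OF \<psi>] by simp
  finally have "(LINT x|leb01. complex_of_real (deriv \<psi> x)) = 0"
    by (simp only: integral_complex_of_real of_real_0)
  moreover have "(LINT x|leb01. (c + f x) * of_real (deriv \<psi> x))
      = c * (LINT x|leb01. of_real (deriv \<psi> x)) + (LINT x|leb01. f x * of_real (deriv \<psi> x))"
    using integrable_mult_continuous(1)[OF f cont] integrable_leb01_continuous[OF cont]
    by (simp add: distrib_right del: integral_complex_of_real)
  ultimately show "(LINT x|leb01. (c + f x) * of_real (deriv \<psi> x)) = - (LINT x|leb01. g x * of_real (\<psi> x))"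
    using assms(1) \<psi> by (simp add: weakly_diff_def)
qed

section \<open>Elements of \<open>H2\<close> as affine functions plus double primitives\<close>

lemma LINT_power:
  assumes "0 \<le> x" "x \<le> 1"
  shows "(LINT t|leb01. (if t < x then t ^ n else 0)) = x ^ Suc n / (of_nat n + 1)"
proof -
  have "(LINT t|leb01. (if t < x then t ^ n else 0)) = (LINT t|leb01. (if 0 < t \<and> t < x then t ^ n else 0))"
    by (rule LINT_leb01_cong) auto
  also have "\<dots> = x ^ Suc n / (of_nat n + 1) - 0 ^ Suc n / (of_nat n + 1)"
  proof (rule LINT_leb01_FTC)
    show "((\<lambda>t. t ^ Suc n / (real n + 1)) has_vector_derivative t ^ n) (at t within {0..x})" for t
      unfolding has_real_derivative_iff_has_vector_derivative[symmetric]
      by (rule DERIV_cong[OF DERIV_cdivide[OF DERIV_pow]]) (simp add: field_simps)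
  qed (use assms in \<open>auto intro!: continuous_intros\<close>)
  finally show ?thesis by simp
qed

lemma int_below_cong_AE:
  assumes "AE x in leb01. f x = g x" "f \<in> borel_measurable leb01" "g \<in> borel_measurable leb01"
  shows "int_below f = int_below g"
proof
  fix x
  note assms(2,3)[measurable]
  show "int_below f x = int_below g x"
    unfolding int_below_def
    by (intro integral_cong_AE; (measurable; fail)?) (use assms(1) in eventually_elim, simp)
qed

lemma int_below_add:
  assumes "integrable leb01 f" "integrable leb01 g"
  shows "int_below (\<lambda>t. f t + g t) x = int_below f x + int_below g x"
proof -
  have "int_below (\<lambda>t. f t + g t) x
      = (LINT t|leb01. (if t < x then f t else 0) + (if t < x then g t else 0))"
    unfolding int_below_def by (rule LINT_leb01_cong) simp
  then show ?thesis using assms by (simp add: int_below_def)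
qed

lemma int_below_const: "0 \<le> x \<Longrightarrow> x \<le> 1 \<Longrightarrow> int_below (\<lambda>t. c) x = c * of_real x"
proof -
  assume x: "0 \<le> x" "x \<le> 1"
  have "int_below (\<lambda>t. c) x = (LINT t|leb01. c * of_real (if t < x then t ^ 0 else 0))"
    unfolding int_below_def by (rule LINT_leb01_cong) simp
  also have "\<dots> = c * of_real (LINT t|leb01. (if t < x then t ^ 0 else 0))"
    by (subst integral_mult_right_zero, subst integral_complex_of_real) (rule refl)
  also have "\<dots> = c * of_real x"
    by (subst LINT_power[OF x, of 0]) simp
  finally show ?thesis .
qed

text \<open>Normal form of an element of \<open>H2\<close>: \<open>g\<close> is the second
  derivative, \<open>a\<close> and \<open>b\<close> are the value and the slope at 0.\<close>

definition H2_fun :: "complex \<Rightarrow> complex \<Rightarrow> (real \<Rightarrow> complex) \<Rightarrow> real \<Rightarrow> complex" where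
  "H2_fun a b g x = a + b * of_real x + int_below (int_below g) x"

lemma H2_fun_continuous: "integrable leb01 g \<Longrightarrow> continuous_on S (H2_fun a b g)"
  unfolding H2_fun_def by (intro continuous_intros int_below_continuous integrable_int_below)

lemma H2_fun_eq:
  assumes "integrable leb01 g" "0 \<le> x" "x \<le> 1"
  shows "H2_fun a b g x = a + int_below (\<lambda>t. b + int_below g t) x"
  using assms by (simp add: H2_fun_def int_below_add int_below_const)

text \<open>Each weak antiderivative is a constant plus \<open>int_below\<close>; integrating the
  inner constant once more gives the linear term.\<close>

lemma H2_cases:
  assumes "u \<in> H2"
  obtains a b where "AE x in leb01. rep_l2 u x = H2_fun a b (rep_l2 (weak_deriv2 u)) x"
proof -
  obtain v w where vw: "has_weak_deriv u v" "has_weak_deriv v w"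
    using assms by (auto simp: H2_def)
  then have w: "weak_deriv2 u = w" by (simp add: weak_deriv2_def weak_deriv_eq)
  obtain b where b: "AE x in leb01. rep_l2 v x = b + int_below (rep_l2 w) x"
    using vw weakly_diff_imp_int_below[of "rep_l2 v" "rep_l2 w"] by (auto simp: has_weak_deriv_iff)
  obtain a where a: "AE x in leb01. rep_l2 u x = a + int_below (rep_l2 v) x"
    using vw weakly_diff_imp_int_below[of "rep_l2 u" "rep_l2 v"] by (auto simp: has_weak_deriv_iff)
  have eq: "int_below (rep_l2 v) = int_below (\<lambda>t. b + int_below (rep_l2 w) t)"
    by (rule int_below_cong_AE[OF b]) (auto intro!: borel_measurable_integrable)
  have "AE x in leb01. a + int_below (rep_l2 v) x = H2_fun a b (rep_l2 w) x"
    unfolding eq by (rule AE_leb01I) (simp add: H2_fun_eq)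
  with a have "AE x in leb01. rep_l2 u x = H2_fun a b (rep_l2 w) x"
    by eventually_elim simp
  then show ?thesis using that by (simp add: w)
qed

text \<open>Converse of \<open>H2_cases\<close>. It produces the Riesz representative and, later,
  the test elements with prescribed second derivative.\<close>

lemma H2_fun_in_H2:
  fixes a b :: complex
  assumes g: "square_integrable g"
  defines "u \<equiv> abs_l2 (H2_fun a b g)"
  shows "u \<in> H2" "weak_deriv2 u = abs_l2 g" "AE x in leb01. rep_l2 u x = H2_fun a b g x"
proof -
  have gi [simp]: "integrable leb01 g" using g by (rule square_integrableD)
  define v where "v = (\<lambda>x. b + int_below g x)"
  have cont_v: "continuous_on S v" for S
    unfolding v_def by (intro continuous_intros int_below_continuous gi)
  have [simp]: "integrable leb01 v" by (rule integrable_leb01_continuous[OF cont_v])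
  have sq: "square_integrable v" "square_integrable (H2_fun a b g)"
    by (intro square_integrable_continuous cont_v H2_fun_continuous[OF gi])+
  note rep = AE_rep_abs_l2[OF g] AE_rep_abs_l2[OF sq(1)] AE_rep_abs_l2[OF sq(2)]
  note meas = square_integrableD(1)[OF g] square_integrableD(1)[OF sq(1)]
    square_integrableD(1)[OF sq(2)] square_integrableD(1)[OF square_integrable_rep_l2]
  have "weakly_diff v g"
    unfolding v_def by (intro weakly_diff_add_const weakly_diff_int_below) auto
  then have vg: "has_weak_deriv (abs_l2 v) (abs_l2 g)"
    unfolding has_weak_deriv_iff
    by (rule weakly_diff_cong[rotated 2]) (use rep[THEN AE_symmetric] meas in simp_all)
  have "weakly_diff (\<lambda>x. a + int_below v x) v"
    by (intro weakly_diff_add_const weakly_diff_int_below) auto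
  then have uv: "has_weak_deriv u (abs_l2 v)"
    unfolding has_weak_deriv_iff
  proof (rule weakly_diff_cong[rotated 2])
    have "AE x in leb01. a + int_below v x = H2_fun a b g x"
      unfolding v_def by (rule AE_leb01I) (simp add: H2_fun_eq)
    with rep(3) show "AE x in leb01. a + int_below v x = rep_l2 u x"
      unfolding u_def by eventually_elim simp
    show "(\<lambda>x. a + int_below v x) \<in> borel_measurable leb01"
      by (intro continuous_measurable_leb01 continuous_intros int_below_continuous) simp
  qed (use rep[THEN AE_symmetric] meas in simp_all)
  show "u \<in> H2" using uv vg by (auto simp: H2_def)
  show "weak_deriv2 u = abs_l2 g" using uv vg by (simp add: weak_deriv2_def weak_deriv_eq)
  show "AE x in leb01. rep_l2 u x = H2_fun a b g x" using rep(3) by (simp add: u_def)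
qed

section \<open>Riesz representation in H2\<close>

lemma int_below_diff:
  assumes "integrable leb01 f" "integrable leb01 g"
  shows "int_below (\<lambda>t. f t - g t) = (\<lambda>x. int_below f x - int_below g x)"
proof
  fix x
  have "int_below (\<lambda>t. f t - g t) x
      = (LINT t|leb01. (if t < x then f t else 0) - (if t < x then g t else 0))"
    unfolding int_below_def by (rule LINT_leb01_cong) simp
  then show "int_below (\<lambda>t. f t - g t) x = int_below f x - int_below g x"
    using assms by (simp add: int_below_def)
qed

lemma int_above_diff:
  assumes "integrable leb01 f" "integrable leb01 g"
  shows "int_above (\<lambda>t. f t - g t) = (\<lambda>x. int_above f x - int_above g x)"
proof
  fix x
  have "int_above (\<lambda>t. f t - g t) x
      = (LINT t|leb01. (if x < t then f t else 0) - (if x < t then g t else 0))"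
    unfolding int_above_def by (rule LINT_leb01_cong) simp
  then show "int_above (\<lambda>t. f t - g t) x = int_above f x - int_above g x"
    using assms by (simp add: int_above_def)
qed

lemma int_below_cnj: "cnj (int_below g x) = int_below (\<lambda>t. cnj (g t)) x"
  unfolding int_below_def by (simp only: Bochner_Integration.integral_cnj[symmetric] if_distrib complex_cnj_zero)

lemma integrable_leb01_power [simp]: "integrable leb01 (\<lambda>t::real. t ^ n)"
  by (intro integrable_leb01_continuous continuous_intros)

lemma integrable_leb01_id [simp]: "integrable leb01 (\<lambda>t::real. t)"
  using integrable_leb01_power[of 1] by simp

lemma integrable_leb01_cut_power [simp]: "integrable leb01 (\<lambda>t::real. if t < x then t ^ n else 0)"
  by (rule Bochner_Integration.integrable_bound[where f = "\<lambda>t. t ^ n"]) auto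

lemma LINT_power_full: "(LINT t|leb01. t ^ n) = 1 / (of_nat n + 1)"
proof -
  have "(LINT t|leb01. t ^ n) = (LINT t|leb01. (if t < 1 then t ^ n else 0))"
    by (rule LINT_leb01_cong) simp
  then show ?thesis using LINT_power[of 1 n] by simp
qed

text \<open>Keeping the power of t instead of a plain supremum gains a factor 1 / (n + 1) per
  integration; without this gain the fixed-point estimate would not give a constant below 1.\<close>

lemma int_below_power_bound:
  assumes [simp]: "integrable leb01 g" and bound: "\<And>t. 0 < t \<Longrightarrow> t < 1 \<Longrightarrow> cmod (g t) \<le> K * t ^ n"
    and x: "0 \<le> x" "x \<le> 1"
  shows "cmod (int_below g x) \<le> K * (x ^ Suc n / (of_nat n + 1))"
proof -
  have "cmod (int_below g x) \<le> (LINT t|leb01. cmod (if t < x then g t else 0))"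
    unfolding int_below_def by (rule integral_norm_bound)
  also have "\<dots> \<le> (LINT t|leb01. K * (if t < x then t ^ n else 0))"
    by (rule integral_mono) (auto intro!: integrable_norm simp: bound)
  also have "\<dots> = K * (x ^ Suc n / (of_nat n + 1))"
    using LINT_power[OF x] by simp
  finally show ?thesis .
qed

lemma int_above_const_bound:
  assumes [simp]: "integrable leb01 g" and bound: "\<And>t. 0 < t \<Longrightarrow> t < 1 \<Longrightarrow> cmod (g t) \<le> K"
    and x: "0 \<le> x" "x \<le> 1"
  shows "cmod (int_above g x) \<le> K * (1 - x)"
proof -
  have "cmod (int_above g x) \<le> (LINT t|leb01. cmod (if x < t then g t else 0))"
    unfolding int_above_def by (rule integral_norm_bound)
  also have "\<dots> \<le> (LINT t|leb01. K * (1 - (if t < x then t ^ 0 else 0)))"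
  proof (rule integral_mono)
    show "integrable leb01 (\<lambda>t. cmod (if x < t then g t else 0))"
      by (intro integrable_norm integrable_cut_above assms)
    show "integrable leb01 (\<lambda>t. K * (1 - (if t < x then t ^ 0 else 0)))"
      by (intro integrable_mult_right Bochner_Integration.integrable_diff integrable_leb01_cut_power) simp
    show "cmod (if x < t then g t else 0) \<le> K * (1 - (if t < x then t ^ 0 else 0))"
      if "t \<in> space leb01" for t
      \<comment> \<open>The value t = x needs 0 \<le> K, as there the left side is 0 and the right
        side is \<open>K\<close>; the bound at 1/2 supplies it.\<close>
      using bound[of t] that order_trans[OF norm_ge_zero bound[of "1/2"]] by simp
  qed
  also have "\<dots> = K * (1 - (LINT t|leb01. (if t < x then t ^ 0 else 0)))"
    by (subst integral_mult_right_zero, subst Bochner_Integration.integral_diff)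
      (auto simp: leb01.prob_space simp del: power_0)
  also have "\<dots> = K * (1 - x)" by (subst LINT_power[OF x]) simp
  finally show ?thesis .
qed

text \<open>The inner integration leaves at most K (1 - t), and the mean of that is K / 2.\<close>

lemma int_above_twice_bound:
  assumes g: "integrable leb01 g" and bound: "\<And>t. 0 < t \<Longrightarrow> t < 1 \<Longrightarrow> cmod (g t) \<le> K"
  shows "cmod (int_above (int_above g) x) \<le> K / 2"
proof -
  have "cmod (int_above (int_above g) x) \<le> (LINT t|leb01. cmod (int_above g t))"
    by (rule int_above_bound[OF integrable_int_above[OF g]])
  also have "\<dots> \<le> (LINT t|leb01. K * (1 - t ^ 1))"
  proof (rule integral_mono)
    show "integrable leb01 (\<lambda>t. cmod (int_above g t))"
      by (intro integrable_norm integrable_int_above g)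
    show "integrable leb01 (\<lambda>t. K * (1 - t ^ 1))"
      by (intro integrable_leb01_continuous continuous_intros)
    show "cmod (int_above g t) \<le> K * (1 - t ^ 1)" if "t \<in> space leb01" for t
      using int_above_const_bound[OF g bound, of t] that by simp
  qed
  also have "\<dots> = K * (1 - (LINT t|leb01. t ^ 1))"
    by (subst integral_mult_right_zero, subst Bochner_Integration.integral_diff) simp_all
  also have "\<dots> = K / 2" by (subst LINT_power_full) simp
  finally show ?thesis .
qed

text \<open>The component of \<open>f\<close> that is orthogonal to the affine functions.\<close>

definition affine_perp :: "(real \<Rightarrow> complex) \<Rightarrow> real \<Rightarrow> complex" where
  "affine_perp f x = f x - (LINT t|leb01. f t) - 12 * of_real (x - 1/2) * (LINT t|leb01. f t * of_real (t - 1/2))"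

lemma integrable_mult_affine:
  fixes f :: "real \<Rightarrow> complex"
  assumes "integrable leb01 f" shows "integrable leb01 (\<lambda>t. f t * of_real (t - 1/2))"
  by (rule integrable_mult_continuous(1)[OF assms]) (intro continuous_intros)

lemma integrable_affine_perp [simp]:
  "integrable leb01 f \<Longrightarrow> integrable leb01 (affine_perp f)"
  unfolding affine_perp_def
  by (intro Bochner_Integration.integrable_diff)
    (assumption | intro integrable_leb01_continuous continuous_intros)+

text \<open>1 and x - 1/2 are orthogonal with squared norms 1 and 1/12; this is the origin of the
  factor 12 in \<open>affine_perp\<close>.\<close>

lemma LINT_affine:
  "(LINT x|leb01. complex_of_real (x - 1/2)) = 0"
  "(LINT x|leb01. complex_of_real (x - 1/2) * of_real (x - 1/2)) = 1/12"
proof -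
  have id: "(LINT x|leb01. x) = 1/2" using LINT_power_full[of 1] by simp
  then have "(LINT x|leb01. x - 1/2) = 0" by simp
  then show "(LINT x|leb01. complex_of_real (x - 1/2)) = 0"
    by (simp only: integral_complex_of_real of_real_0)
  have "(LINT x|leb01. (x ^ 2 - x) + 1/4) = 1/12"
    using id by (simp add: LINT_power_full)
  also have "(LINT x|leb01. (x ^ 2 - x) + 1/4) = (LINT x|leb01. (x - 1/2) * (x - 1/2))"
    by (rule LINT_leb01_cong) (simp add: power2_eq_square algebra_simps)
  finally have "(LINT x|leb01. (x - 1/2) * (x - 1/2)) = 1/12" .
  then show "(LINT x|leb01. complex_of_real (x - 1/2) * of_real (x - 1/2)) = 1/12"
    by (simp only: integral_complex_of_real of_real_mult[symmetric]) simp
qed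

lemma affine_perp_orthogonal:
  assumes f [simp]: "integrable leb01 f"
  shows "(LINT x|leb01. affine_perp f x * (c + d * of_real x)) = 0"
proof -
  define m0 m1 where "m0 = (LINT t|leb01. f t)" and "m1 = (LINT t|leb01. f t * of_real (t - 1/2))"
  have i: "integrable leb01 (\<lambda>x. complex_of_real (x - 1/2))"
    "integrable leb01 (\<lambda>x. complex_of_real (x - 1/2) * of_real (x - 1/2))"
    by (intro integrable_leb01_continuous continuous_intros)+
  \<comment> \<open>The affine factor is expanded in the orthogonal basis as (c + d/2) + d (x -
    1/2).\<close>
  have eq: "affine_perp f x * (c + d * of_real x) = (c + d / 2) * f x + d * (f x * of_real (x - 1/2))
      - (c + d / 2) * m0 - (d * m0 + 12 * (c + d / 2) * m1) * of_real (x - 1/2)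
      - 12 * d * m1 * (of_real (x - 1/2) * of_real (x - 1/2))" for x
    unfolding affine_perp_def m0_def[symmetric] m1_def[symmetric] by (simp add: field_simps)
  have "(LINT x|leb01. affine_perp f x * (c + d * of_real x)) = (c + d / 2) * m0 + d * m1
      - (c + d / 2) * m0 - (d * m0 + 12 * (c + d / 2) * m1) * 0 - 12 * d * m1 * (1/12)"
    unfolding eq LINT_affine[symmetric]
    using i integrable_mult_affine[OF f] by (simp add: m0_def[symmetric] m1_def[symmetric] del: of_real_diff of_real_mult)
  then show ?thesis by simp
qed

lemma affine_perp_diff:
  assumes [simp]: "integrable leb01 f" "integrable leb01 g"
  shows "affine_perp (\<lambda>x. f x - g x) = (\<lambda>x. affine_perp f x - affine_perp g x)"
proof
  fix x
  show "affine_perp (\<lambda>x. f x - g x) x = affine_perp f x - affine_perp g x"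
    using integrable_mult_affine[OF assms(1)] integrable_mult_affine[OF assms(2)]
    by (simp add: affine_perp_def left_diff_distrib right_diff_distrib del: of_real_diff)
qed

text \<open>7/3 = 1 + 1/3 + 1: the function itself, its mean (at most K/3), and 12 * 1/2 times its
  centred first moment (at most K/6).\<close>

lemma affine_perp_bound:
  assumes f: "integrable leb01 f" and bound: "\<And>t. 0 < t \<Longrightarrow> t < 1 \<Longrightarrow> cmod (f t) \<le> K * t ^ 2"
    and x: "0 < x" "x < 1" and K: "0 \<le> K"
  shows "cmod (affine_perp f x) \<le> 7/3 * K"
proof -
  have i: "integrable leb01 (\<lambda>t. K * t ^ 2)" "(LINT t|leb01. K * t ^ 2) = K / 3"
    by (simp_all add: LINT_power_full)
  have "cmod (LINT t|leb01. f t) \<le> (LINT t|leb01. cmod (f t))" by (rule integral_norm_bound)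
  also have "\<dots> \<le> (LINT t|leb01. K * t ^ 2)"
    by (rule integral_mono[OF _ i(1)]) (use f bound in auto)
  finally have m0: "cmod (LINT t|leb01. f t) \<le> K / 3" by (simp only: i)
  have "cmod (LINT t|leb01. f t * of_real (t - 1/2)) \<le> (LINT t|leb01. cmod (f t * of_real (t - 1/2)))"
    by (rule integral_norm_bound)
  also have "\<dots> \<le> (LINT t|leb01. 1/2 * (K * t ^ 2))"
  proof (rule integral_mono)
    fix t assume "t \<in> space leb01"
    then have t: "0 < t" "t < 1" by auto
    have "cmod (f t * of_real (t - 1/2)) = cmod (f t) * \<bar>t - 1/2\<bar>" by (simp add: norm_mult del: of_real_diff)
    also have "\<dots> \<le> (K * t ^ 2) * (1/2)"
    proof (intro mult_mono bound)
      show "\<bar>t - 1/2\<bar> \<le> 1/2" using t by arith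
    qed (use t K in auto)
    finally show "cmod (f t * of_real (t - 1/2)) \<le> 1/2 * (K * t ^ 2)" by (simp only: mult_ac)
  next
    show "integrable leb01 (\<lambda>t. cmod (f t * of_real (t - 1/2)))"
      by (rule integrable_norm[OF integrable_mult_affine[OF f]])
  qed simp
  also have "\<dots> = 1/2 * (K / 3)" by (subst integral_mult_right_zero) (simp only: i)
  finally have m1: "cmod (LINT t|leb01. f t * of_real (t - 1/2)) \<le> K / 6" by simp
  have fx: "cmod (f x) \<le> K"
    using bound[OF x] mult_left_mono[OF power_le_one[of x 2] K] x by simp
  have "cmod (affine_perp f x) \<le> cmod (f x) + cmod (LINT t|leb01. f t)
      + cmod (12 * of_real (x - 1/2) * (LINT t|leb01. f t * of_real (t - 1/2)))"
    unfolding affine_perp_def by (rule order_trans[OF norm_triangle_ineq4 add_right_mono[OF norm_triangle_ineq4]])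
  also have "cmod (12 * of_real (x - 1/2) * (LINT t|leb01. f t * of_real (t - 1/2)))
      = 12 * \<bar>x - 1/2\<bar> * cmod (LINT t|leb01. f t * of_real (t - 1/2))"
    by (simp only: norm_mult norm_of_real) simp
  also have "\<dots> \<le> 12 * (1/2) * (K / 6)"
  proof (intro mult_mono m1)
    show "\<bar>x - 1/2\<bar> \<le> 1/2" using x by arith
  qed (use K in auto)
  finally show ?thesis using m0 fx by simp
qed

text \<open>
  Writing \<open>w = a + b x + \<integral>\<integral> g\<close> and \<open>g = A + k\<close>, the orthogonality relations say that \<open>w - B\<close> is
  orthogonal to affine functions and that \<open>k = - (\<integral>\<integral>)\<^sup>* (w - B)\<close>.  Eliminating \<open>a, b\<close> by
  \<open>affine_perp\<close> leaves a fixed-point equation for \<open>k\<close>, contracting with constant \<open>7/12\<close>.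
\<close>

definition riesz_map :: "(real \<Rightarrow> complex) \<Rightarrow> (real \<Rightarrow> complex) \<Rightarrow> (real \<Rightarrow> complex) \<Rightarrow> real \<Rightarrow> complex" where
  "riesz_map A B k x =
    - int_above (int_above (affine_perp (\<lambda>t. int_below (int_below (\<lambda>s. A s + k s)) t - B t))) x"

text \<open>7/12 = 1/2 * 7/3 * 1/2: two integrations from below turn \<open>K\<close> into K t^2 /
  2, the projection costs 7/3, and two integrations from above gain another 1/2.\<close>

lemma riesz_map_contraction:
  assumes [simp]: "integrable leb01 A" "integrable leb01 B" "integrable leb01 k" "integrable leb01 l"
    and bound: "\<And>t. cmod (k t - l t) \<le> K" and K: "0 \<le> K"
  shows "cmod (riesz_map A B k x - riesz_map A B l x) \<le> 7/12 * K"
proof -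
  define h where "h k = (\<lambda>t. int_below (int_below (\<lambda>s. A s + k s)) t - B t)" for k
  \<comment> \<open>The order of \<open>l\<close> and \<open>k\<close> is reversed because
    \<open>riesz_map\<close> carries a minus sign.\<close>
  define d where "d = int_below (int_below (\<lambda>s. l s - k s))"
  have [simp]: "integrable leb01 (h k)" if "integrable leb01 k" for k
    using that unfolding h_def by simp
  have [simp]: "integrable leb01 d" unfolding d_def by simp
  have hd: "(\<lambda>t. h l t - h k t) = d"
  proof -
    have 1: "int_below (\<lambda>s. l s - k s)
        = (\<lambda>x. int_below (\<lambda>s. A s + l s) x - int_below (\<lambda>s. A s + k s) x)"
      using int_below_diff[of "\<lambda>s. A s + l s" "\<lambda>s. A s + k s"] by simp
    have "d = (\<lambda>x. int_below (int_below (\<lambda>s. A s + l s)) x - int_below (int_below (\<lambda>s. A s + k s)) x)"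
      unfolding d_def 1 by (rule int_below_diff) simp_all
    then show ?thesis by (simp add: h_def)
  qed
  have "riesz_map A B k x - riesz_map A B l x
      = int_above (int_above (affine_perp (h l))) x - int_above (int_above (affine_perp (h k))) x"
    by (simp add: riesz_map_def h_def)
  also have "\<dots> = int_above (int_above (affine_perp d)) x"
    unfolding hd[symmetric] by (simp add: affine_perp_diff int_above_diff)
  also have "cmod \<dots> \<le> (7/3 * (K / 2)) / 2"
  proof (rule int_above_twice_bound)
    show "integrable leb01 (affine_perp d)" by simp
    fix t :: real assume t: "0 < t" "t < 1"
    show "cmod (affine_perp d t) \<le> 7/3 * (K / 2)"
    proof (rule affine_perp_bound[OF _ _ t])
      fix t :: real assume t: "0 < t" "t < 1"
      have "cmod (int_below (int_below (\<lambda>s. l s - k s)) t) \<le> K * (t ^ Suc 1 / (of_nat 1 + 1))"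
      proof (rule int_below_power_bound)
        fix t :: real assume t: "0 < t" "t < 1"
        have "cmod (int_below (\<lambda>s. l s - k s) t) \<le> K * (t ^ Suc 0 / (of_nat 0 + 1))"
          by (rule int_below_power_bound) (use t bound in \<open>auto simp: norm_minus_commute\<close>)
        then show "cmod (int_below (\<lambda>s. l s - k s) t) \<le> K * t ^ 1" by simp
      qed (use t in auto)
      then show "cmod (d t) \<le> K / 2 * t\<^sup>2" by (simp add: d_def numeral_2_eq_2)
    qed (use K in auto)
  qed
  finally show ?thesis by simp
qed

text \<open>Banach's theorem in the bounded continuous functions on the line. Having
  \<open>k\<close> and not g = A + k as the unknown is what permits the supremum norm although
  \<open>A\<close> and \<open>B\<close> are merely integrable.\<close>

lemma riesz_map_fixed_point:
  assumes A: "integrable leb01 A" and B: "integrable leb01 B"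
  shows "\<exists>k. continuous_on UNIV k \<and> (\<forall>x. riesz_map A B k x = k x)"
proof -
  have int: "integrable leb01 (apply_bcontfun k)" for k :: "real \<Rightarrow>\<^sub>C complex"
    by (rule integrable_leb01_continuous) simp
  define \<Phi> where "\<Phi> k = Bcontfun (riesz_map A B (apply_bcontfun k))" for k
  have \<Phi>: "apply_bcontfun (\<Phi> k) = riesz_map A B (apply_bcontfun k)" for k
  proof -
    define f where "f = affine_perp (\<lambda>t. int_below (int_below (\<lambda>s. A s + apply_bcontfun k s)) t - B t)"
    have f: "integrable leb01 f"
      unfolding f_def using A B int[of k] by simp
    have eq: "riesz_map A B (apply_bcontfun k) = (\<lambda>x. - int_above (int_above f) x)"
      by (simp add: riesz_map_def f_def fun_eq_iff)
    have "bounded (range (\<lambda>x. - int_above (int_above f) x))"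
      using int_above_bound[OF integrable_int_above[OF f]] by (auto simp: bounded_iff)
    moreover have "continuous_on UNIV (\<lambda>x. - int_above (int_above f) x)"
      by (intro continuous_on_minus int_above_continuous integrable_int_above f)
    ultimately show ?thesis
      unfolding \<Phi>_def eq by (intro Bcontfun_inverse) (simp add: bcontfun_def)
  qed
  have "\<exists>!k. \<Phi> k = k"
  proof (rule banach_fix_type[of "7/12"])
    show "\<forall>k l. dist (\<Phi> k) (\<Phi> l) \<le> 7/12 * dist k l"
    proof (intro allI dist_bound)
      fix k l :: "real \<Rightarrow>\<^sub>C complex" and x
      have "cmod (apply_bcontfun k t - apply_bcontfun l t) \<le> dist k l" for t
        using dist_bounded[of k t l] by (simp add: dist_norm)
      then show "dist (apply_bcontfun (\<Phi> k) x) (apply_bcontfun (\<Phi> l) x) \<le> 7/12 * dist k l"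
        unfolding \<Phi> dist_norm by (intro riesz_map_contraction int A B) simp_all
    qed
  qed simp_all
  then obtain k where "\<Phi> k = k" by blast
  then have "riesz_map A B (apply_bcontfun k) x = apply_bcontfun k x" for x
    using \<Phi>[of k] by simp
  then show ?thesis by (intro exI[of _ "apply_bcontfun k"]) simp
qed

lemma LINT_cnj_cong:
  assumes "AE x in leb01. f x = f' x" "AE x in leb01. g x = g' x"
    and "f \<in> borel_measurable leb01" "f' \<in> borel_measurable leb01"
      "g \<in> borel_measurable leb01" "g' \<in> borel_measurable leb01"
  shows "(LINT x|leb01. f x * cnj (g x)) = (LINT x|leb01. f' x * cnj (g' x))"
proof (rule integral_cong_AE)
  have cnj: "cnj \<in> borel_measurable borel"
    by (intro borel_measurable_continuous_onI continuous_intros)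
  show "(\<lambda>x. f x * cnj (g x)) \<in> borel_measurable leb01"
    by (intro borel_measurable_times assms(3) measurable_compose[OF assms(5) cnj])
  show "(\<lambda>x. f' x * cnj (g' x)) \<in> borel_measurable leb01"
    by (intro borel_measurable_times assms(4) measurable_compose[OF assms(6) cnj])
  show "AE x in leb01. f x * cnj (g x) = f' x * cnj (g' x)"
    using assms(1,2) by eventually_elim simp
qed

text \<open>In the application \<open>A\<close> is u2 and \<open>B\<close> collects the coefficients
  of cnj \<phi>1 in \<open>T_form\<close>, so this gives the first component of the representative
  of \<open>T_form\<close>.\<close>

theorem riesz_H2:
  assumes A: "square_integrable A" and B: "square_integrable B"
  shows "\<exists>w\<in>H2. \<forall>\<phi>\<in>H2. inner_H2 w \<phi> =
    (LINT x|leb01. A x * cnj (rep_l2 (weak_deriv2 \<phi>) x)) + (LINT x|leb01. B x * cnj (rep_l2 \<phi> x))"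
proof -
  have Ai [simp]: "integrable leb01 A" and Bi [simp]: "integrable leb01 B"
    using A B by (auto intro: square_integrableD)
  obtain k where k: "continuous_on UNIV k" and fix_k: "\<And>x. riesz_map A B k x = k x"
    using riesz_map_fixed_point[OF Ai Bi] by blast
  define g where "g x = A x + k x" for x
  have g: "square_integrable g"
    unfolding g_def by (intro square_integrable_add A square_integrable_continuous k)
  then have gi [simp]: "integrable leb01 g" by (rule square_integrableD)
  define h where "h x = int_below (int_below g) x - B x" for x
  have hi [simp]: "integrable leb01 h"
    unfolding h_def by simp
  define F where "F = affine_perp h"
  have Fi [simp]: "integrable leb01 F" unfolding F_def by simp
  have kF: "k x = - int_above (int_above F) x" for x
    using fix_k[of x] by (simp add: riesz_map_def F_def h_def[abs_def] g_def[abs_def])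
  define m1 where "m1 = (LINT t|leb01. h t * of_real (t - 1/2))"
  \<comment> \<open>\<open>a\<close> and \<open>b\<close> are read off from the affine part that
    \<open>affine_perp\<close> subtracts from \<open>h\<close>, so that the candidate minus
    \<open>B\<close> is exactly \<open>F\<close>.\<close>
  define b where "b = - 12 * m1"
  define a where "a = 6 * m1 - (LINT t|leb01. h t)"
  have wF: "H2_fun a b g x = B x + F x" for x
    unfolding F_def affine_perp_def m1_def[symmetric] by (simp add: H2_fun_def h_def[of x] a_def b_def algebra_simps)
  have "F = (\<lambda>x. H2_fun a b g x + (- 1) * B x)"
    using wF by (simp add: fun_eq_iff)
  then have F: "square_integrable F"
    using square_integrable_add[OF square_integrable_continuous[OF H2_fun_continuous[OF gi]]
        square_integrable_bounded_mult[OF B, of "\<lambda>_. - 1" 1]] by simp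
  define w where "w = abs_l2 (H2_fun a b g)"
  note w = H2_fun_in_H2[OF g, of a b, folded w_def]
  show ?thesis
  proof (intro bexI[OF _ w(1)] ballI)
    fix \<phi> assume "\<phi> \<in> H2"
    then obtain c d where \<phi>: "AE x in leb01. rep_l2 \<phi> x = H2_fun c d (rep_l2 (weak_deriv2 \<phi>)) x"
      by (rule H2_cases)
    define p where "p = rep_l2 \<phi>"
    define p2 where "p2 = rep_l2 (weak_deriv2 \<phi>)"
    have p: "square_integrable p" "square_integrable p2" by (simp_all add: p_def p2_def)
    have cp: "square_integrable (\<lambda>x. cnj (p x))" "square_integrable (\<lambda>x. cnj (p2 x))"
      using p by (auto intro: square_integrable_cnj)
    have [simp]: "integrable leb01 p2" "integrable leb01 (\<lambda>x. cnj (p2 x))"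
      by (rule square_integrableD(3)[OF p(2)] square_integrableD(3)[OF cp(2)])+
    have "inner_H2 w \<phi> = (LINT x|leb01. (B x + F x) * cnj (p x)) + (LINT x|leb01. g x * cnj (p2 x))"
      unfolding inner_H2_def inner_L2_def
    proof (rule arg_cong2[where f = "(+)"])
      show "(LINT x|leb01. rep_l2 w x * cnj (rep_l2 \<phi> x)) = (LINT x|leb01. (B x + F x) * cnj (p x))"
        unfolding p_def wF[symmetric] using w(3)
        by (intro LINT_cnj_cong)
          (auto intro: square_integrableD(1) square_integrable_continuous[OF H2_fun_continuous[OF gi]] square_integrableD(1)[OF square_integrable_rep_l2])
      show "(LINT x|leb01. rep_l2 (weak_deriv2 w) x * cnj (rep_l2 (weak_deriv2 \<phi>) x))
          = (LINT x|leb01. g x * cnj (p2 x))"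
        unfolding p2_def w(2) using AE_rep_abs_l2[OF g]
        by (intro LINT_cnj_cong) (auto intro: square_integrableD(1)[OF g] square_integrableD(1)[OF square_integrable_rep_l2])
    qed
    also have "(LINT x|leb01. (B x + F x) * cnj (p x)) = (LINT x|leb01. B x * cnj (p x)) + (LINT x|leb01. F x * cnj (p x))"
      using square_integrable_mult_integrable[OF B cp(1)] square_integrable_mult_integrable[OF F cp(1)]
      by (simp add: distrib_right)
    also have "(LINT x|leb01. g x * cnj (p2 x)) = (LINT x|leb01. A x * cnj (p2 x)) + (LINT x|leb01. k x * cnj (p2 x))"
      using square_integrable_mult_integrable[OF A cp(2)]
        square_integrable_mult_integrable[OF square_integrable_continuous[OF k] cp(2)]
      by (simp add: g_def distrib_right)
    \<comment> \<open>In the normal form of \<phi>, \<open>F\<close> annihilates the affine part,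
      and transposing both primitives turns the rest into a pairing with the double
      \<open>int_above\<close> of \<open>F\<close>, which is -k.\<close>
    also have "(LINT x|leb01. F x * cnj (p x)) = - (LINT x|leb01. k x * cnj (p2 x))"
    proof -
      define q where "q x = cnj (p2 x)" for x
      have qi [simp]: "integrable leb01 q" unfolding q_def by simp
      have "(LINT x|leb01. F x * cnj (p x)) = (LINT x|leb01. F x * cnj (H2_fun c d p2 x))"
        using \<phi> unfolding p_def p2_def
        by (intro LINT_cnj_cong) (auto intro: square_integrableD(1)[OF F] square_integrableD(1)[OF square_integrable_rep_l2]
            square_integrableD(1)[OF square_integrable_continuous[OF H2_fun_continuous[OF integrable_rep_l2]]])
      also have "\<dots> = (LINT x|leb01. F x * (cnj c + cnj d * of_real x) + F x * int_below (int_below q) x)"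
        by (simp add: H2_fun_def int_below_cnj q_def[abs_def] distrib_left)
      also have "\<dots> = (LINT x|leb01. F x * (cnj c + cnj d * of_real x)) + (LINT x|leb01. F x * int_below (int_below q) x)"
        by (intro Bochner_Integration.integral_add integrable_mult_continuous(1) Fi continuous_intros
            int_below_continuous integrable_int_below qi)
      also have "(LINT x|leb01. F x * (cnj c + cnj d * of_real x)) = 0"
        unfolding F_def by (rule affine_perp_orthogonal) simp
      also have "(LINT x|leb01. F x * int_below (int_below q) x) = (LINT x|leb01. int_below (int_below q) x * F x)"
        by (simp only: mult.commute)
      also have "\<dots> = (LINT x|leb01. q x * int_above (int_above F) x)"
        by (subst LINT_int_below_mult, simp, simp, subst LINT_int_below_mult) simp_all
      also have "\<dots> = - (LINT x|leb01. k x * cnj (p2 x))"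
        by (simp add: kF q_def mult.commute)
      finally show ?thesis by simp
    qed
    finally show "inner_H2 w \<phi> = (LINT x|leb01. A x * cnj (rep_l2 (weak_deriv2 \<phi>) x))
        + (LINT x|leb01. B x * cnj (rep_l2 \<phi> x))"
      by (simp add: p_def p2_def)
  qed
qed

section \<open>The equations behind a zero of T\<close>

definition l2_norm :: "l2 \<Rightarrow> real" where
  "l2_norm u = sqrt (LINT x|leb01. (cmod (rep_l2 u x))\<^sup>2)"

lemma l2_norm_nonneg [simp]: "0 \<le> l2_norm u"
  by (simp add: l2_norm_def)

lemma l2_norm_power2: "(l2_norm u)\<^sup>2 = (LINT x|leb01. (cmod (rep_l2 u x))\<^sup>2)"
  by (simp add: l2_norm_def)

lemma inner_L2_self: "inner_L2 u u = of_real ((l2_norm u)\<^sup>2)"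
  unfolding inner_L2_def l2_norm_power2 complex_norm_square[symmetric] of_real_power[symmetric]
  by (rule integral_complex_of_real)

lemma norm_X_power2:
  "(norm_X u)\<^sup>2 = (l2_norm (fst u))\<^sup>2 + (l2_norm (weak_deriv2 (fst u)))\<^sup>2 + (l2_norm (snd u))\<^sup>2"
  by (simp add: norm_X_def inner_X_def inner_H2_def inner_L2_self)

lemma integrable_rep_cnj_rep: "integrable leb01 (\<lambda>x. rep_l2 u x * cnj (rep_l2 v x))"
  by (intro square_integrable_mult_integrable square_integrable_cnj square_integrable_rep_l2)

text \<open>As \<open>l2\<close> carries no subtraction, the squared distance is expressed by four
  inner products on the left and by representatives on the right.\<close>

lemma inner_L2_polarization:
  "inner_L2 u u - inner_L2 v u - (inner_L2 u v - inner_L2 v v)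
    = of_real (LINT x|leb01. (cmod (rep_l2 u x - rep_l2 v x))\<^sup>2)"
proof -
  have "inner_L2 u u - inner_L2 v u - (inner_L2 u v - inner_L2 v v)
      = (LINT x|leb01. rep_l2 u x * cnj (rep_l2 u x) - rep_l2 v x * cnj (rep_l2 u x)
          - (rep_l2 u x * cnj (rep_l2 v x) - rep_l2 v x * cnj (rep_l2 v x)))"
    by (simp add: inner_L2_def integrable_rep_cnj_rep)
  also have "\<dots> = (LINT x|leb01. complex_of_real ((cmod (rep_l2 u x - rep_l2 v x))\<^sup>2))"
    by (rule LINT_leb01_cong) (simp only: complex_norm_square complex_cnj_diff, simp add: algebra_simps)
  finally show ?thesis by (simp only: integral_complex_of_real)
qed

lemma square_integrable_diff:
  assumes "square_integrable f" "square_integrable g"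
  shows "square_integrable (\<lambda>x. f x - g x)"
  using square_integrable_add[OF assms(1) square_integrable_bounded_mult[OF assms(2), of "\<lambda>_. - 1" 1]]
  by simp

lemma LINT_power2_eq_0D:
  assumes "square_integrable f" "(LINT x|leb01. (cmod (f x))\<^sup>2) = 0"
  shows "AE x in leb01. f x = 0"
  using assms by (subst (asm) integral_nonneg_eq_0_iff_AE) (auto intro: square_integrableD)

text \<open>Testing with \<open>w\<close> and \<open>w'\<close> themselves gives four values that
  combine to the sum of the squared distances of both components and of the second
  derivatives.\<close>

lemma inner_X_unique:
  assumes w: "w \<in> X_space" "w' \<in> X_space"
    and eq: "\<And>\<phi>. \<phi> \<in> X_space \<Longrightarrow> inner_X w \<phi> = inner_X w' \<phi>"
  shows "w = w'"
proof -
  define D where "D u v = (LINT x|leb01. (cmod (rep_l2 u x - rep_l2 v x))\<^sup>2)" for u v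
  have D0: "0 \<le> D u v" for u v by (simp add: D_def)
  have D_eq: "u = v" if "D u v = 0" for u v
  proof -
    have "AE x in leb01. rep_l2 u x - rep_l2 v x = 0"
      using that unfolding D_def by (intro LINT_power2_eq_0D square_integrable_diff) simp_all
    then have "AE x in leb01. rep_l2 u x = rep_l2 v x" by eventually_elim simp
    then show ?thesis by (rule l2_eqI)
  qed
  have "inner_X w w - inner_X w' w - (inner_X w w' - inner_X w' w') = 0"
    using eq w by simp
  also have "inner_X w w - inner_X w' w - (inner_X w w' - inner_X w' w')
      = of_real (D (fst w) (fst w') + D (weak_deriv2 (fst w)) (weak_deriv2 (fst w')) + D (snd w) (snd w'))"
    unfolding D_def of_real_add inner_L2_polarization[symmetric]
    by (simp add: inner_X_def inner_H2_def)
  finally have "D (fst w) (fst w') + D (weak_deriv2 (fst w)) (weak_deriv2 (fst w')) + D (snd w) (snd w') = 0"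
    by (simp only: of_real_eq_0_iff)
  then have "D (fst w) (fst w') = 0" "D (snd w) (snd w') = 0"
    using D0[of "fst w" "fst w'"] D0[of "weak_deriv2 (fst w)" "weak_deriv2 (fst w')"] D0[of "snd w" "snd w'"]
    by linarith+
  then show ?thesis by (intro prod_eqI D_eq)
qed

lemma weak_deriv2_zero: "weak_deriv2 0 = 0"
proof -
  have "weakly_diff (rep_l2 0) (rep_l2 0)"
    by (rule weakly_diff_cong[where f = "\<lambda>_. 0" and g = "\<lambda>_. 0"])
      (use AE_symmetric[OF AE_rep_zero_l2] square_integrableD(1)[OF square_integrable_rep_l2[of 0]]
        in \<open>simp_all add: weakly_diff_def\<close>)
  then show ?thesis by (simp add: weak_deriv2_def weak_deriv_eq has_weak_deriv_iff)
qed

lemma inner_L2_zero: "inner_L2 0 v = 0"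
proof -
  have "inner_L2 0 v = (LINT x|leb01. 0 * cnj (rep_l2 v x))"
    unfolding inner_L2_def using AE_rep_zero_l2
    by (intro LINT_cnj_cong) (auto intro: square_integrableD(1)[OF square_integrable_rep_l2])
  then show ?thesis by simp
qed

lemma int_below_twice_bound:
  assumes g: "integrable leb01 g"
  shows "cmod (int_below (int_below g) x) \<le> (LINT t|leb01. cmod (g t))"
proof -
  have "cmod (int_below (int_below g) x) \<le> (LINT t|leb01. cmod (int_below g t))"
    by (rule int_below_bound[OF integrable_int_below[OF g]])
  also have "\<dots> \<le> (LINT s|leb01. LINT t|leb01. cmod (g t))"
    by (intro integral_mono int_below_bound integrable_norm integrable_int_below g) simp
  finally show ?thesis by simp
qed

text \<open>The double primitive in the normal form is at most the L1 norm, hence the L2 norm, of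
  the second derivative. Both estimates share \<open>a\<close> and \<open>b\<close>, which is needed
  to compare u1 with its affine part.\<close>

lemma H2_bounded:
  assumes "u \<in> H2"
  obtains a b where "AE x in leb01. cmod (rep_l2 u x - (a + b * of_real x)) \<le> l2_norm (weak_deriv2 u)"
    "AE x in leb01. cmod (rep_l2 u x) \<le> cmod a + cmod b + l2_norm (weak_deriv2 u)"
proof -
  obtain a b where ab: "AE x in leb01. rep_l2 u x = H2_fun a b (rep_l2 (weak_deriv2 u)) x"
    using H2_cases[OF assms] by blast
  have e: "cmod (int_below (int_below (rep_l2 (weak_deriv2 u))) x) \<le> l2_norm (weak_deriv2 u)" for x
    unfolding l2_norm_def
    by (rule order_trans[OF int_below_twice_bound L1_le_L2_norm]) simp_all
  have "AE x in leb01. cmod (rep_l2 u x - (a + b * of_real x)) \<le> l2_norm (weak_deriv2 u)"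
    using ab by eventually_elim (simp add: H2_fun_def e)
  moreover have l: "AE x in leb01. cmod (a + b * of_real x) \<le> cmod a + cmod b"
  proof (rule AE_leb01I)
    fix x :: real assume "0 < x" "x < 1"
    then show "cmod (a + b * of_real x) \<le> cmod a + cmod b"
      by (intro order_trans[OF norm_triangle_ineq]) (simp add: norm_mult mult_left_le)
  qed
  ultimately have "AE x in leb01. cmod (rep_l2 u x) \<le> cmod a + cmod b + l2_norm (weak_deriv2 u)"
  proof eventually_elim
    case (elim x)
    then show ?case
      using norm_triangle_ineq[of "rep_l2 u x - (a + b * of_real x)" "a + b * of_real x"] by simp
  qed
  with \<open>AE x in leb01. cmod (rep_l2 u x - (a + b * of_real x)) \<le> l2_norm (weak_deriv2 u)\<close>
  show ?thesis by (rule that)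
qed

text \<open>The representative of \<open>T_form\<close> is the pair of \<open>w1\<close> from
  \<open>riesz_H2\<close> and the class of \<open>E\<close>. By uniqueness it equals
  \<open>T_op\<close>, so \<open>E\<close> vanishes almost everywhere and the functional represented
  by \<open>w1\<close> is 0.\<close>

lemma T_op_eq_0D:
  fixes \<chi>1 \<chi>2 q :: "real \<Rightarrow> real"
  assumes u: "u \<in> X_space"
    and meas: "\<chi>1 \<in> borel_measurable leb01" "\<chi>2 \<in> borel_measurable leb01" "q \<in> borel_measurable leb01"
    and bound: "AE x in leb01. \<bar>\<chi>1 x\<bar> \<le> M" "AE x in leb01. \<bar>\<chi>2 x\<bar> \<le> M" "AE x in leb01. \<bar>q x\<bar> \<le> Q"
    and T: "T_op \<chi>1 \<chi>2 q \<omega> u = 0"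
  defines "u1 \<equiv> rep_l2 (fst u)" and "u2 \<equiv> rep_l2 (snd u)"
  shows "AE x in leb01. rep_l2 (weak_deriv2 (fst u)) x + \<omega>\<^sup>2 * of_real (q x) * u1 x
      + \<omega>\<^sup>2 * of_real (\<chi>1 x) * u2 x * cnj (u1 x) = 0"
    and "square_integrable (\<lambda>x. 4 * \<omega>\<^sup>2 * of_real (q x) * u2 x + \<omega>\<^sup>2 * of_real (\<chi>2 x) * (u1 x)\<^sup>2)"
    and "\<And>\<phi>. \<phi> \<in> H2 \<Longrightarrow> (LINT x|leb01. u2 x * cnj (rep_l2 (weak_deriv2 \<phi>) x))
      + (LINT x|leb01. (4 * \<omega>\<^sup>2 * of_real (q x) * u2 x + \<omega>\<^sup>2 * of_real (\<chi>2 x) * (u1 x)\<^sup>2) * cnj (rep_l2 \<phi> x)) = 0"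
proof -
  note meas[measurable]
  have sq: "square_integrable u1" "square_integrable u2" by (simp_all add: u1_def u2_def)
  have [measurable]: "u1 \<in> borel_measurable leb01" "u2 \<in> borel_measurable leb01"
    "(\<lambda>x. cnj (u1 x)) \<in> borel_measurable leb01"
    using sq square_integrable_cnj[OF sq(1)] by (auto intro: square_integrableD(1))
  \<comment> \<open>The products of u2 with cnj u1 and of u1 with itself are a priori only
    integrable; boundedness of u1 makes them square integrable, so that \<open>E\<close> defines a
    class and \<open>riesz_H2\<close> applies to \<open>B\<close>.\<close>
  obtain N where N: "AE x in leb01. cmod (u1 x) \<le> N"
    using u H2_bounded[of "fst u"] unfolding u1_def X_space_def by (metis mem_Times_iff)
  define E where "E x = rep_l2 (weak_deriv2 (fst u)) x + \<omega>\<^sup>2 * of_real (q x) * u1 x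
      + \<omega>\<^sup>2 * of_real (\<chi>1 x) * cnj (u1 x) * u2 x" for x
  define B where "B x = 4 * \<omega>\<^sup>2 * of_real (q x) * u2 x + \<omega>\<^sup>2 * of_real (\<chi>2 x) * u1 x * u1 x" for x
  have E: "square_integrable E"
    unfolding E_def
  proof (intro square_integrable_add square_integrable_rep_l2)
    show "square_integrable (\<lambda>x. \<omega>\<^sup>2 * of_real (q x) * u1 x)"
    proof (rule square_integrable_bounded_mult[OF sq(1)])
      show "AE x in leb01. cmod (\<omega>\<^sup>2 * of_real (q x)) \<le> (cmod \<omega>)\<^sup>2 * Q"
        using bound(3) by eventually_elim (simp add: norm_mult norm_power mult_left_mono)
    qed measurable
    show "square_integrable (\<lambda>x. \<omega>\<^sup>2 * of_real (\<chi>1 x) * cnj (u1 x) * u2 x)"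
    proof (rule square_integrable_bounded_mult[OF sq(2)])
      show "AE x in leb01. cmod (\<omega>\<^sup>2 * of_real (\<chi>1 x) * cnj (u1 x)) \<le> (cmod \<omega>)\<^sup>2 * M * N"
        using bound(1) N by eventually_elim
          (auto simp: norm_mult norm_power intro!: mult_mono mult_left_mono mult_nonneg_nonneg elim: order_trans[rotated])
    qed measurable
  qed
  have B: "square_integrable B"
    unfolding B_def
  proof (rule square_integrable_add)
    show "square_integrable (\<lambda>x. 4 * \<omega>\<^sup>2 * of_real (q x) * u2 x)"
    proof (rule square_integrable_bounded_mult[OF sq(2)])
      show "AE x in leb01. cmod (4 * \<omega>\<^sup>2 * of_real (q x)) \<le> 4 * (cmod \<omega>)\<^sup>2 * Q"
        using bound(3) by eventually_elim (simp add: norm_mult norm_power mult_left_mono)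
    qed measurable
    show "square_integrable (\<lambda>x. \<omega>\<^sup>2 * of_real (\<chi>2 x) * u1 x * u1 x)"
    proof (rule square_integrable_bounded_mult[OF sq(1)])
      show "AE x in leb01. cmod (\<omega>\<^sup>2 * of_real (\<chi>2 x) * u1 x) \<le> (cmod \<omega>)\<^sup>2 * M * N"
        using bound(2) N by eventually_elim
          (auto simp: norm_mult norm_power intro!: mult_mono mult_left_mono mult_nonneg_nonneg elim: order_trans[rotated])
    qed measurable
  qed
  obtain w1 where w1: "w1 \<in> H2" "\<And>\<phi>. \<phi> \<in> H2 \<Longrightarrow> inner_H2 w1 \<phi> =
      (LINT x|leb01. u2 x * cnj (rep_l2 (weak_deriv2 \<phi>) x)) + (LINT x|leb01. B x * cnj (rep_l2 \<phi> x))"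
    using riesz_H2[OF sq(2) B] by blast
  have form: "inner_X (w1, abs_l2 E) \<phi> = T_form \<chi>1 \<chi>2 q \<omega> u \<phi>" if "\<phi> \<in> X_space" for \<phi>
  proof -
    have "inner_L2 (abs_l2 E) (snd \<phi>) = (LINT x|leb01. E x * cnj (rep_l2 (snd \<phi>) x))"
      unfolding inner_L2_def using AE_rep_abs_l2[OF E]
      by (intro LINT_cnj_cong) (auto intro: square_integrableD(1)[OF E] square_integrableD(1)[OF square_integrable_rep_l2])
    moreover have "inner_H2 w1 (fst \<phi>) = (LINT x|leb01. u2 x * cnj (rep_l2 (weak_deriv2 (fst \<phi>)) x)
        + B x * cnj (rep_l2 (fst \<phi>) x))"
      using that B sq(2) by (subst Bochner_Integration.integral_add)
        (auto simp: X_space_def w1(2) intro!: square_integrable_mult_integrable square_integrable_cnj)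
    ultimately show ?thesis
      unfolding inner_X_def T_form_def Let_def
      by (simp add: E_def B_def u1_def u2_def power2_eq_square algebra_simps)
  qed
  have wX: "(w1, abs_l2 E) \<in> X_space" using w1 by (simp add: X_space_def)
  have "T_op \<chi>1 \<chi>2 q \<omega> u = (w1, abs_l2 E)"
    unfolding T_op_def
  proof (rule the_equality)
    show "w = (w1, abs_l2 E)"
      if "w \<in> X_space \<and> (\<forall>\<phi>\<in>X_space. inner_X w \<phi> = T_form \<chi>1 \<chi>2 q \<omega> u \<phi>)" for w
      using that wX form by (intro inner_X_unique) auto
  qed (use wX form in auto)
  then have zero: "w1 = 0" "abs_l2 E = 0" using T by (auto simp: zero_prod_def)
  have "AE x in leb01. E x = 0"
    using AE_rep_abs_l2[OF E] AE_rep_zero_l2 unfolding zero by eventually_elim simp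
  then show "AE x in leb01. rep_l2 (weak_deriv2 (fst u)) x + \<omega>\<^sup>2 * of_real (q x) * u1 x
      + \<omega>\<^sup>2 * of_real (\<chi>1 x) * u2 x * cnj (u1 x) = 0"
    by eventually_elim (simp add: E_def mult_ac)
  have B_eq: "4 * \<omega>\<^sup>2 * of_real (q x) * u2 x + \<omega>\<^sup>2 * of_real (\<chi>2 x) * (u1 x)\<^sup>2 = B x" for x
    by (simp add: B_def power2_eq_square mult_ac)
  show "square_integrable (\<lambda>x. 4 * \<omega>\<^sup>2 * of_real (q x) * u2 x + \<omega>\<^sup>2 * of_real (\<chi>2 x) * (u1 x)\<^sup>2)"
    unfolding B_eq by (rule B)
  show "(LINT x|leb01. u2 x * cnj (rep_l2 (weak_deriv2 \<phi>) x))
      + (LINT x|leb01. (4 * \<omega>\<^sup>2 * of_real (q x) * u2 x + \<omega>\<^sup>2 * of_real (\<chi>2 x) * (u1 x)\<^sup>2) * cnj (rep_l2 \<phi> x)) = 0"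
    if "\<phi> \<in> H2" for \<phi>
    unfolding B_eq w1(2)[OF that, symmetric] zero
    by (simp add: inner_H2_def weak_deriv2_zero inner_L2_zero)
qed

section \<open>Coercivity of the weighted affine moments\<close>

lemma integrable_bounded_mult_continuous:
  fixes \<rho> :: "real \<Rightarrow> real" and p :: "real \<Rightarrow> complex"
  assumes [measurable]: "\<rho> \<in> borel_measurable leb01" and bound: "AE x in leb01. \<bar>\<rho> x\<bar> \<le> M"
    and p: "continuous_on {0..1} p"
  shows "integrable leb01 (\<lambda>x. of_real (\<rho> x) * p x)"
proof (rule integrable_mult_continuous(1)[OF _ p])
  show "integrable leb01 (\<lambda>x. complex_of_real (\<rho> x))"
    using bound by (intro leb01.integrable_const_bound[where B = M]) simp_all
qed

text \<open>A nonzero affine function has at most one root, so the integrand is positive almost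
  everywhere.\<close>

lemma weighted_square_pos:
  fixes \<rho> :: "real \<Rightarrow> real"
  assumes meas: "\<rho> \<in> borel_measurable leb01" and bound: "AE x in leb01. \<bar>\<rho> x\<bar> \<le> M"
    and pos: "AE x in leb01. \<rho> x > 0"
    and ab: "a \<noteq> 0 \<or> b \<noteq> 0"
  shows "0 < (LINT x|leb01. \<rho> x * (a + b * x)\<^sup>2)"
proof -
  have "integrable leb01 (\<lambda>x. complex_of_real (\<rho> x) * of_real ((a + b * x)\<^sup>2))"
    by (rule integrable_bounded_mult_continuous[OF meas bound]) (intro continuous_intros)
  then have i: "integrable leb01 (\<lambda>x. \<rho> x * (a + b * x)\<^sup>2)"
    by (simp only: of_real_mult[symmetric] complex_of_real_integrable_eq)
  have nonneg: "AE x in leb01. 0 \<le> \<rho> x * (a + b * x)\<^sup>2"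
    using pos by eventually_elim simp
  have "(LINT x|leb01. \<rho> x * (a + b * x)\<^sup>2) \<noteq> 0"
  proof
    assume "(LINT x|leb01. \<rho> x * (a + b * x)\<^sup>2) = 0"
    then have "AE x in leb01. \<rho> x * (a + b * x)\<^sup>2 = 0"
      using integral_nonneg_eq_0_iff_AE[OF i nonneg] by simp
    then have "AE x in leb01. False"
      \<comment> \<open>For b = 0 the quotient is 0 by convention; that case is settled by a being
        nonzero.\<close>
      using pos AE_leb01_neq[of "- a / b"]
    proof eventually_elim
      case (elim x)
      then have "a + b * x = 0" by simp
      with ab elim show False by (cases "b = 0") (auto simp: field_simps eq_neg_iff_add_eq_0)
    qed
    then show False using leb01.prob_space by simp
  qed
  then show ?thesis using integral_nonneg_AE[OF nonneg] by simp
qed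

lemma affine_square_moments_nonzero:
  fixes \<rho> :: "real \<Rightarrow> real" and a b :: complex
  assumes meas: "\<rho> \<in> borel_measurable leb01" and bound: "AE x in leb01. \<bar>\<rho> x\<bar> \<le> M"
    and pos: "AE x in leb01. \<rho> x > 0"
    and 0: "(LINT x|leb01. of_real (\<rho> x) * (a + b * of_real x)\<^sup>2) = 0"
    and 1: "(LINT x|leb01. of_real (\<rho> x) * (a + b * of_real x)\<^sup>2 * of_real x) = 0"
  shows "a = 0 \<and> b = 0"
proof (cases "b = 0")
  case True
  have "0 < (LINT x|leb01. \<rho> x * (1 + 0 * x)\<^sup>2)"
    by (rule weighted_square_pos[OF meas bound pos]) simp
  moreover have "(LINT x|leb01. of_real (\<rho> x) * (a + b * of_real x)\<^sup>2) = of_real (LINT x|leb01. \<rho> x) * a\<^sup>2"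
    by (simp add: True)
  ultimately show ?thesis using 0 True by simp
next
  case False
  define \<alpha> \<beta> where "\<alpha> = Re (- a / b)" and "\<beta> = Im (- a / b)"
  \<comment> \<open>Hence a + b x = b (x - z) with root z = \<alpha> + i \<beta>.\<close>
  have z: "a = - b * (of_real \<alpha> + \<i> * of_real \<beta>)"
    using False unfolding \<alpha>_def \<beta>_def complex_eq[symmetric] by simp
  define p where "p = (LINT x|leb01. \<rho> x * (- \<alpha> + 1 * x)\<^sup>2)"
  have p: "0 < p"
    unfolding p_def by (rule weighted_square_pos[OF meas bound pos]) simp
  have int: "integrable leb01 (\<lambda>x. of_real (\<rho> x) * f x)" if "continuous_on {0..1} f" for f :: "real \<Rightarrow> complex"
    by (rule integrable_bounded_mult_continuous[OF meas bound that])
  have intr: "integrable leb01 (\<lambda>x. \<rho> x * f x)" if "continuous_on {0..1} f" for f :: "real \<Rightarrow> real"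
  proof -
    have "integrable leb01 (\<lambda>x. complex_of_real (\<rho> x) * of_real (f x))"
      by (rule int) (intro continuous_intros that)
    then show ?thesis by (simp only: of_real_mult[symmetric] complex_of_real_integrable_eq)
  qed
  \<comment> \<open>Splitting used below: (x - z)^2 (x - \<alpha>) = P x + c (x - \<alpha>)^2 with
    \<open>P\<close> real and \<open>c\<close> purely imaginary.\<close>
  define P where "P x = (x - \<alpha>) ^ 3 - \<beta>\<^sup>2 * (x - \<alpha>)" for x :: real
  define c where "c = - 2 * \<i> * of_real \<beta>"
  have iP: "integrable leb01 (\<lambda>x. complex_of_real (\<rho> x * P x))"
    unfolding P_def by (rule integrable_of_real[OF intr]) (intro continuous_intros)
  have ip: "integrable leb01 (\<lambda>x. complex_of_real (\<rho> x * (- \<alpha> + 1 * x)\<^sup>2))"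
    by (rule integrable_of_real[OF intr]) (intro continuous_intros)
  text \<open>With \<open>z = \<alpha> + i \<beta>\<close> the root of the affine function, the imaginary part of
    \<open>(x - z)\<^sup>2 (x - \<alpha>)\<close> is \<open>- 2 \<beta> (x - \<alpha>)\<^sup>2\<close>, which has a sign; so \<open>z\<close> is real, and then
    \<open>(x - z)\<^sup>2\<close> itself has a sign.\<close>
  have "0 = (LINT x|leb01. of_real (\<rho> x) * (a + b * of_real x)\<^sup>2 * of_real x)
      - of_real \<alpha> * (LINT x|leb01. of_real (\<rho> x) * (a + b * of_real x)\<^sup>2)"
    by (simp add: 0 1)
  also have "\<dots> = (LINT x|leb01. of_real (\<rho> x) * ((a + b * of_real x)\<^sup>2 * of_real x)
      - of_real \<alpha> * (of_real (\<rho> x) * (a + b * of_real x)\<^sup>2))"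
  proof -
    have "integrable leb01 (\<lambda>x. complex_of_real (\<rho> x) * ((a + b * of_real x)\<^sup>2 * of_real x))"
      "integrable leb01 (\<lambda>x. of_real \<alpha> * (complex_of_real (\<rho> x) * (a + b * of_real x)\<^sup>2))"
      by (intro int integrable_mult_right continuous_intros)+
    then show ?thesis
      by (simp only: Bochner_Integration.integral_diff integral_mult_right_zero mult.assoc)
  qed
  also have "\<dots> = (LINT x|leb01. b\<^sup>2 * (of_real (\<rho> x * P x) + c * of_real (\<rho> x * (- \<alpha> + 1 * x)\<^sup>2)))"
    by (rule LINT_leb01_cong) (simp add: z P_def c_def power2_eq_square power3_eq_cube algebra_simps)
  also have "\<dots> = b\<^sup>2 * (of_real (LINT x|leb01. \<rho> x * P x) + c * of_real p)"
    by (simp only: integral_mult_right_zero Bochner_Integration.integral_add[OF iP integrable_mult_right[OF ip]]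
        integral_complex_of_real p_def)
  finally have "of_real (LINT x|leb01. \<rho> x * P x) + c * of_real p = 0"
    using False by simp
  then have "Im (of_real (LINT x|leb01. \<rho> x * P x) + c * of_real p) = 0" by (simp only: zero_complex.sel)
  then have "\<beta> * p = 0" by (simp add: c_def)
  then have "\<beta> = 0" using p by simp
  then have "(LINT x|leb01. of_real (\<rho> x) * (a + b * of_real x)\<^sup>2)
      = (LINT x|leb01. b\<^sup>2 * of_real (\<rho> x * (- \<alpha> + 1 * x)\<^sup>2))"
    by (intro LINT_leb01_cong) (simp add: z power2_eq_square algebra_simps)
  also have "\<dots> = b\<^sup>2 * of_real p"
    unfolding p_def by (simp only: integral_mult_right_zero integral_complex_of_real)
  finally show ?thesis using 0 False p by simp
qed

text \<open>The right side is continuous in (a, b), homogeneous of degree two, and nonzero on the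
  compact unit sphere of C^2; \<open>c\<close> is its minimum there. It depends on the weight alone,
  which is how \<delta> comes to depend on \<open>\<chi>2\<close>.\<close>

lemma affine_square_moments_coercive:
  fixes \<rho> :: "real \<Rightarrow> real"
  assumes meas: "\<rho> \<in> borel_measurable leb01" and bound: "AE x in leb01. \<bar>\<rho> x\<bar> \<le> M"
    and pos: "AE x in leb01. \<rho> x > 0"
  shows "\<exists>c>0. \<forall>a b. c * ((cmod a)\<^sup>2 + (cmod b)\<^sup>2) \<le>
    cmod (LINT x|leb01. of_real (\<rho> x) * (a + b * of_real x)\<^sup>2)
    + cmod (LINT x|leb01. of_real (\<rho> x) * (a + b * of_real x)\<^sup>2 * of_real x)"
proof -
  define S where "S n a b = (LINT x|leb01. of_real (\<rho> x) * (a + b * of_real x)\<^sup>2 * of_real x ^ n)"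
    for n and a b :: complex
  define m where "m n = (LINT x|leb01. complex_of_real (\<rho> x) * of_real x ^ n)" for n
  have i: "integrable leb01 (\<lambda>x. complex_of_real (\<rho> x) * of_real x ^ n)" for n
    by (rule integrable_bounded_mult_continuous[OF meas bound]) (intro continuous_intros)
  \<comment> \<open>As a quadratic form in (a, b) with fixed coefficients, \<open>S n\<close> is
    visibly continuous and homogeneous.\<close>
  have S: "S n a b = a\<^sup>2 * m n + 2 * a * b * m (Suc n) + b\<^sup>2 * m (Suc (Suc n))" for n a b
  proof -
    have "S n a b = (LINT x|leb01. a\<^sup>2 * (of_real (\<rho> x) * of_real x ^ n)
        + 2 * a * b * (of_real (\<rho> x) * of_real x ^ Suc n) + b\<^sup>2 * (of_real (\<rho> x) * of_real x ^ Suc (Suc n)))"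
      unfolding S_def by (rule LINT_leb01_cong) (simp add: power2_eq_square algebra_simps)
    also have "\<dots> = a\<^sup>2 * m n + 2 * a * b * m (Suc n) + b\<^sup>2 * m (Suc (Suc n))"
      unfolding m_def
      by (simp only: Bochner_Integration.integral_add integral_mult_right_zero i integrable_mult_right Bochner_Integration.integrable_add)
    finally show ?thesis .
  qed
  define f where "f p = cmod (S 0 (fst p) (snd p)) + cmod (S 1 (fst p) (snd p))" for p
  have cont: "continuous_on (sphere 0 1) f"
    unfolding f_def S by (intro continuous_intros)
  have "(1, 0) \<in> sphere (0 :: complex \<times> complex) 1" by (simp add: norm_Pair)
  then have ne: "sphere (0 :: complex \<times> complex) 1 \<noteq> {}" by blast
  obtain p0 where p0: "p0 \<in> sphere 0 1" and min: "\<And>p. p \<in> sphere 0 1 \<Longrightarrow> f p0 \<le> f p"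
    using continuous_attains_inf[OF compact_sphere ne cont] by blast
  have "f p0 \<noteq> 0"
  proof
    assume "f p0 = 0"
    then have "S 0 (fst p0) (snd p0) = 0" "S 1 (fst p0) (snd p0) = 0"
      unfolding f_def by (metis add_nonneg_eq_0_iff norm_eq_zero norm_ge_zero)+
    then have "fst p0 = 0 \<and> snd p0 = 0"
      by (intro affine_square_moments_nonzero[OF meas bound pos]) (simp_all add: S_def)
    then have "p0 = 0" by (simp add: prod_eq_iff)
    with p0 show False by simp
  qed
  moreover have "0 \<le> f p0" by (simp add: f_def)
  ultimately have c: "0 < f p0" by simp
  have "f p0 * ((cmod a)\<^sup>2 + (cmod b)\<^sup>2) \<le> cmod (S 0 a b) + cmod (S 1 a b)" for a b
  proof (cases "(a, b) = 0")
    case False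
    define t where "t = norm (a, b)"
    have t: "0 < t" "t\<^sup>2 = (cmod a)\<^sup>2 + (cmod b)\<^sup>2"
      unfolding t_def using False by (simp_all only: zero_less_norm_iff) (simp_all add: norm_Pair)
    have scale: "S n a b = of_real (t\<^sup>2) * S n (a / of_real t) (b / of_real t)" for n
      using t(1) by (simp add: S field_simps power2_eq_square)
    have "norm (a / of_real t, b / of_real t) = 1"
    proof -
      have "(norm (a / of_real t, b / of_real t))\<^sup>2 = ((cmod a)\<^sup>2 + (cmod b)\<^sup>2) / t\<^sup>2"
        by (simp add: norm_Pair norm_divide power_divide add_divide_distrib)
      then have "(norm (a / of_real t, b / of_real t))\<^sup>2 = 1\<^sup>2"
        unfolding t(2)[symmetric] using t(1) by simp
      then show ?thesis by (rule power2_eq_imp_eq) simp_all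
    qed
    then have "f p0 \<le> f (a / of_real t, b / of_real t)" by (intro min) simp
    then have "f p0 * t\<^sup>2 \<le> f (a / of_real t, b / of_real t) * t\<^sup>2" by (rule mult_right_mono) simp
    also have "\<dots> = cmod (S 0 a b) + cmod (S 1 a b)"
      unfolding f_def scale[of 0] scale[of 1] norm_mult by (simp add: norm_power algebra_simps)
    finally show ?thesis by (simp add: t(2))
  qed (simp add: zero_prod_def)
  with c show ?thesis by (intro exI[of _ "f p0"]) (simp add: S_def)
qed

section \<open>Absence of small solutions\<close>

lemma AE_rep_abs_zero: "AE x in leb01. rep_l2 (abs_l2 (\<lambda>_. 0)) x = 0"
  using AE_rep_zero_l2 by (simp add: zero_l2_def)

text \<open>A non-integrable \<open>f\<close> has integral 0 by convention, so integrability of the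
  majorant suffices.\<close>

lemma LINT_norm_le:
  fixes f :: "real \<Rightarrow> complex"
  assumes "integrable leb01 g" "AE x in leb01. cmod (f x) \<le> g x"
  shows "cmod (LINT x|leb01. f x) \<le> (LINT x|leb01. g x)"
proof (cases "integrable leb01 f")
  case True
  then show ?thesis
    by (intro order_trans[OF integral_norm_bound] integral_mono_AE assms integrable_norm)
next
  case False
  have "AE x in leb01. 0 \<le> g x"
    using assms(2) by eventually_elim (rule order_trans[OF norm_ge_zero])
  then show ?thesis using False by (simp add: not_integrable_integral_eq integral_nonneg_AE)
qed

text \<open>Everything is measured against N = |a| + |b| + G, a bound for u1: G \<le> s K N, U \<le>
  2 s M N^2, and each moment of the affine part is at most s N^2 (8 Q M + 2 M K). Absorbing
  \<open>G\<close> gives N^2 \<le> 8 L with L = |a|^2 + |b|^2, so coercivity leaves c L \<le> 16 s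
  (8 Q M + 2 M K) L, which forces L = 0.\<close>

lemma small_solution_zero:
  fixes \<chi>1 \<chi>2 q :: "real \<Rightarrow> real" and v1 v2 :: l2 and \<omega> :: complex and M Q r c :: real
  defines "u1 \<equiv> rep_l2 v1" and "u2 \<equiv> rep_l2 v2" and "g \<equiv> rep_l2 (weak_deriv2 v1)"
  defines "B \<equiv> \<lambda>x. 4 * \<omega>\<^sup>2 * of_real (q x) * u2 x + \<omega>\<^sup>2 * of_real (\<chi>2 x) * (u1 x)\<^sup>2"
  assumes v1: "v1 \<in> H2"
    and meas: "\<chi>2 \<in> borel_measurable leb01" "q \<in> borel_measurable leb01"
    and bound: "AE x in leb01. \<bar>\<chi>1 x\<bar> \<le> M" "AE x in leb01. \<bar>\<chi>2 x\<bar> \<le> M" "AE x in leb01. \<bar>q x\<bar> \<le> Q"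
    and MQ: "0 \<le> M" "0 \<le> Q"
    and eq1: "AE x in leb01. g x + \<omega>\<^sup>2 * of_real (q x) * u1 x + \<omega>\<^sup>2 * of_real (\<chi>1 x) * u2 x * cnj (u1 x) = 0"
    and B: "square_integrable B"
    and eq2: "\<And>\<phi>. \<phi> \<in> H2 \<Longrightarrow> (LINT x|leb01. u2 x * cnj (rep_l2 (weak_deriv2 \<phi>) x))
      + (LINT x|leb01. B x * cnj (rep_l2 \<phi> x)) = 0"
    and coercive: "0 < c" "\<And>a b. c * ((cmod a)\<^sup>2 + (cmod b)\<^sup>2) \<le>
      cmod (LINT x|leb01. of_real (\<chi>2 x) * (a + b * of_real x)\<^sup>2)
      + cmod (LINT x|leb01. of_real (\<chi>2 x) * (a + b * of_real x)\<^sup>2 * of_real x)"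
    and r: "l2_norm v2 \<le> r"
    and \<omega>: "0 < cmod \<omega>"
  defines "s \<equiv> (cmod \<omega>)\<^sup>2" and "K \<equiv> 2 * (Q + M * r)"
  assumes small: "s * K \<le> 1/2" "4 * Q * s \<le> 1/2" "s * (16 * (8 * Q * M + 2 * M * K)) < c"
  shows "l2_norm v1 = 0 \<and> l2_norm (weak_deriv2 v1) = 0 \<and> l2_norm v2 = 0"
proof -
  note meas[measurable]
  define G where "G = l2_norm (weak_deriv2 v1)"
  define U where "U = l2_norm v2"
  have sq: "square_integrable u1" "square_integrable u2" "square_integrable g"
    by (simp_all add: u1_def u2_def g_def)
  note [measurable] = sq[THEN square_integrableD(1)]
  have s: "0 < s" using \<omega> by (simp add: s_def)
  have r0: "0 \<le> r" using order_trans[OF l2_norm_nonneg r] .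
  have GU: "0 \<le> G" "0 \<le> U" "U \<le> r" using r by (simp_all add: G_def U_def)
  have G2: "G\<^sup>2 = (LINT x|leb01. (cmod (g x))\<^sup>2)" and U2: "U\<^sup>2 = (LINT x|leb01. (cmod (u2 x))\<^sup>2)"
    by (simp_all add: G_def U_def l2_norm_power2 g_def u2_def)
  have u2_int: "integrable leb01 (\<lambda>x. cmod (u2 x))" "integrable leb01 (\<lambda>x. (cmod (u2 x))\<^sup>2)" "integrable leb01 u2"
    using square_integrableD[OF sq(2)] by auto
  have u2_L1: "(LINT x|leb01. cmod (u2 x)) \<le> U"
    using L1_le_L2_norm[OF sq(2)] by (simp add: U_def l2_norm_def u2_def)
  obtain a b where
    ab: "AE x in leb01. cmod (u1 x - (a + b * of_real x)) \<le> G" and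
    u1N: "AE x in leb01. cmod (u1 x) \<le> cmod a + cmod b + G"
    using H2_bounded[OF v1] unfolding u1_def G_def by blast
  define N where "N = cmod a + cmod b + G"
  have N0: "0 \<le> N" using GU by (simp add: N_def)
  note u1N = u1N[folded N_def]

  \<comment> \<open>The first equation is squared pointwise and integrated. The bound U \<le> r
    turns the product of u2 and cnj u1 into a term linear in \<open>N\<close>.\<close>
  have "G\<^sup>2 \<le> (s * N * 2 * (Q + M * r))\<^sup>2"
  proof -
    have "AE x in leb01. (cmod (g x))\<^sup>2 \<le> 2 * (s * N)\<^sup>2 * (Q\<^sup>2 + M\<^sup>2 * (cmod (u2 x))\<^sup>2)"
      using eq1 u1N bound(1) bound(3)
    proof eventually_elim
      case (elim x)
      have "cmod (g x) = cmod (\<omega>\<^sup>2 * of_real (q x) * u1 x + \<omega>\<^sup>2 * of_real (\<chi>1 x) * u2 x * cnj (u1 x))"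
        using elim(1) by (simp only: add.assoc eq_neg_iff_add_eq_0[symmetric] norm_minus_cancel)
      also have "\<dots> \<le> s * \<bar>q x\<bar> * cmod (u1 x) + s * \<bar>\<chi>1 x\<bar> * cmod (u2 x) * cmod (u1 x)"
        by (rule order_trans[OF norm_triangle_ineq]) (simp add: norm_mult norm_power s_def)
      also have "\<dots> \<le> s * Q * N + s * M * cmod (u2 x) * N"
        using elim s MQ by (intro add_mono mult_mono mult_nonneg_nonneg) auto
      also have "\<dots> = s * N * (Q + M * cmod (u2 x))" by (simp add: algebra_simps)
      finally have "(cmod (g x))\<^sup>2 \<le> (s * N * (Q + M * cmod (u2 x)))\<^sup>2" by (intro power_mono) auto
      also have "\<dots> = (s * N)\<^sup>2 * (Q + M * cmod (u2 x))\<^sup>2" by (rule power_mult_distrib)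
      also have "\<dots> \<le> (s * N)\<^sup>2 * (2 * (Q\<^sup>2 + (M * cmod (u2 x))\<^sup>2))"
        using zero_le_power2[of "Q - M * cmod (u2 x)"]
        by (intro mult_left_mono zero_le_power2) (simp add: power2_eq_square algebra_simps)
      finally show ?case by (simp add: power_mult_distrib algebra_simps)
    qed
    then have "G\<^sup>2 \<le> (LINT x|leb01. 2 * (s * N)\<^sup>2 * (Q\<^sup>2 + M\<^sup>2 * (cmod (u2 x))\<^sup>2))"
      unfolding G2 using square_integrableD(2)[OF sq(3)] u2_int
      by (intro integral_mono_AE) simp_all
    also have "\<dots> = 2 * (s * N)\<^sup>2 * (Q\<^sup>2 + M\<^sup>2 * U\<^sup>2)"
      using u2_int by (simp add: U2)
    also have "\<dots> \<le> 2 * (s * N)\<^sup>2 * (Q\<^sup>2 + M\<^sup>2 * r\<^sup>2)"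
      using GU by (intro mult_left_mono add_left_mono power_mono) auto
    \<comment> \<open>The spare factor 2 completes the right side to a perfect square, so that a
      root can be taken.\<close>
    also have "\<dots> \<le> 2 * (s * N)\<^sup>2 * (2 * (Q + M * r)\<^sup>2)"
    proof (rule mult_left_mono)
      have "0 \<le> Q * (M * r)" "0 \<le> Q\<^sup>2" "0 \<le> (M * r)\<^sup>2" using MQ r0 by simp_all
      then show "Q\<^sup>2 + M\<^sup>2 * r\<^sup>2 \<le> 2 * (Q + M * r)\<^sup>2"
        by (simp add: power2_eq_square algebra_simps)
    qed simp
    also have "\<dots> = (s * N * 2 * (Q + M * r))\<^sup>2" by (simp add: power_mult_distrib)
    finally show ?thesis .
  qed
  then have "G \<le> s * N * 2 * (Q + M * r)"
    by (rule power2_le_imp_le) (use s N0 MQ r0 in simp)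
  then have G: "G \<le> s * K * N" by (simp add: K_def algebra_simps)
  \<comment> \<open>Half of \<open>N\<close> absorbs \<open>G\<close>, leaving \<open>N\<close>
    controlled by the affine coefficients alone.\<close>
  also have "\<dots> \<le> 1/2 * N" using small(1) N0 by (rule mult_right_mono)
  finally have Nab: "N \<le> 2 * (cmod a + cmod b)" by (simp add: N_def)

  have U: "U \<le> 2 * s * M * N\<^sup>2"
  proof (cases "U = 0")
    case True
    then show ?thesis using s MQ by simp
  next
    case False
    with GU have Upos: "0 < U" by simp
    \<comment> \<open>This test element has second derivative u2, so the first integral in
      \<open>eq2\<close> becomes U^2, while |\<phi>| \<le> U. After division by \<open>U\<close> the
      \<open>q\<close> term is absorbed because 4 Q s \<le> 1/2.\<close>
    define \<phi> where "\<phi> = abs_l2 (H2_fun 0 0 u2)"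
    note \<phi> = H2_fun_in_H2[OF sq(2), of 0 0, folded \<phi>_def]
    have \<phi>U: "AE x in leb01. cmod (rep_l2 \<phi> x) \<le> U"
      using \<phi>(3)
    proof eventually_elim
      case (elim x)
      then show ?case
        using order_trans[OF int_below_twice_bound[OF u2_int(3), of x] u2_L1] by (simp add: H2_fun_def)
    qed
    have "(LINT x|leb01. u2 x * cnj (rep_l2 (weak_deriv2 \<phi>) x)) = (LINT x|leb01. u2 x * cnj (u2 x))"
      unfolding \<phi>(2) using AE_rep_abs_l2[OF sq(2)]
      by (intro LINT_cnj_cong) (auto intro: square_integrableD(1)[OF sq(2)] square_integrableD(1)[OF square_integrable_rep_l2])
    also have "\<dots> = of_real (U\<^sup>2)"
      unfolding U2 complex_norm_square[symmetric] by (rule integral_complex_of_real)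
    finally have "of_real (U\<^sup>2) + (LINT x|leb01. B x * cnj (rep_l2 \<phi> x)) = 0"
      using eq2[OF \<phi>(1)] by simp
    then have "cmod (of_real (U\<^sup>2)) = cmod (LINT x|leb01. B x * cnj (rep_l2 \<phi> x))"
      by (simp only: eq_neg_iff_add_eq_0[symmetric] norm_minus_cancel)
    then have "U\<^sup>2 = cmod (LINT x|leb01. B x * cnj (rep_l2 \<phi> x))"
      by (simp only: norm_of_real abs_power2)
    also have "\<dots> \<le> (LINT x|leb01. s * (4 * Q * cmod (u2 x) + M * N\<^sup>2) * U)"
    proof (rule LINT_norm_le)
      show "AE x in leb01. cmod (B x * cnj (rep_l2 \<phi> x)) \<le> s * (4 * Q * cmod (u2 x) + M * N\<^sup>2) * U"
        using \<phi>U u1N bound(2,3)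
      proof eventually_elim
        case (elim x)
        have "cmod (B x) \<le> 4 * s * \<bar>q x\<bar> * cmod (u2 x) + s * \<bar>\<chi>2 x\<bar> * (cmod (u1 x))\<^sup>2"
          unfolding B_def by (rule order_trans[OF norm_triangle_ineq]) (simp add: norm_mult norm_power s_def)
        also have "\<dots> \<le> 4 * s * Q * cmod (u2 x) + s * M * N\<^sup>2"
          using elim s MQ by (intro add_mono mult_mono mult_nonneg_nonneg power_mono) auto
        finally have "cmod (B x) \<le> s * (4 * Q * cmod (u2 x) + M * N\<^sup>2)" by (simp add: algebra_simps)
        then show ?case
          unfolding norm_mult using elim s MQ by (intro mult_mono) (auto intro!: mult_nonneg_nonneg add_nonneg_nonneg)
      qed
    qed (use u2_int in simp)
    also have "\<dots> = s * (4 * Q * (LINT x|leb01. cmod (u2 x)) + M * N\<^sup>2) * U"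
      using u2_int by simp
    also have "\<dots> \<le> s * (4 * Q * U + M * N\<^sup>2) * U"
      using s GU MQ u2_L1 by (intro mult_right_mono mult_left_mono add_right_mono) auto
    finally have "U \<le> s * (4 * Q * U + M * N\<^sup>2)"
      using Upos by (simp add: power2_eq_square)
    also have "\<dots> = (4 * Q * s) * U + s * M * N\<^sup>2" by (simp add: algebra_simps)
    also have "\<dots> \<le> 1/2 * U + s * M * N\<^sup>2"
      using small(2) GU by (intro add_right_mono mult_right_mono) auto
    finally show ?thesis by simp
  qed

  have moment: "cmod (LINT x|leb01. of_real (\<chi>2 x) * (a + b * of_real x)\<^sup>2 * (k + l * of_real x))
      \<le> s * N\<^sup>2 * (8 * Q * M + 2 * M * K)"
    if kl: "\<And>x. 0 < x \<Longrightarrow> x < 1 \<Longrightarrow> cmod (k + l * of_real x) \<le> 1" for k l :: complex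
  proof -
    define p where "p x = k + l * of_real x" for x :: real
    have p1: "AE x in leb01. cmod (p x) \<le> 1" unfolding p_def by (rule AE_leb01I) (rule kl)
    have pc: "continuous_on S p" for S unfolding p_def by (intro continuous_intros)
    have [measurable]: "p \<in> borel_measurable leb01" using pc by (rule continuous_measurable_leb01)
    have sq0: "square_integrable (\<lambda>_. 0)" by (simp add: square_integrable_def)
    \<comment> \<open>The coefficients are conjugated because \<phi> enters \<open>eq2\<close>
      conjugated; its second derivative is 0, so only the integral with \<open>B\<close>
      survives.\<close>
    define \<phi> where "\<phi> = abs_l2 (H2_fun (cnj k) (cnj l) (\<lambda>_. 0))"
    note \<phi> = H2_fun_in_H2[OF sq0, of "cnj k" "cnj l", folded \<phi>_def]
    have \<phi>p: "AE x in leb01. rep_l2 \<phi> x = cnj (p x)"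
    proof -
      have "int_below (\<lambda>_. 0) = (\<lambda>_. 0)" by (simp add: int_below_def fun_eq_iff)
      then show ?thesis using \<phi>(3) by (simp add: H2_fun_def p_def)
    qed
    have "(LINT x|leb01. u2 x * cnj (rep_l2 (weak_deriv2 \<phi>) x)) = (LINT x|leb01. u2 x * cnj 0)"
      unfolding \<phi>(2) using AE_rep_abs_zero
      by (intro LINT_cnj_cong) (auto intro: square_integrableD(1)[OF sq(2)] square_integrableD(1)[OF square_integrable_rep_l2])
    then have "0 = (LINT x|leb01. B x * cnj (rep_l2 \<phi> x))"
      using eq2[OF \<phi>(1)] by simp
    also have "\<dots> = (LINT x|leb01. B x * cnj (cnj (p x)))"
      using \<phi>p square_integrableD(1)[OF square_integrable_continuous[OF continuous_on_cnj[OF pc]]]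
      by (intro LINT_cnj_cong) (auto intro: square_integrableD(1)[OF B] square_integrableD(1)[OF square_integrable_rep_l2])
    finally have Bp: "(LINT x|leb01. B x * p x) = 0" by simp
    define f1 where "f1 x = of_real (\<chi>2 x) * (a + b * of_real x)\<^sup>2 * p x" for x
    \<comment> \<open>\<open>f2\<close> is the moment integrand \<open>f1\<close> minus
      \<open>B p\<close> divided by \<omega>^2, and the subtracted part has integral 0. What is left
      is the error of replacing u1 by its affine part, where the difference of squares is at most G
      * 2 N, and the \<open>q\<close> term, controlled by \<open>U\<close>.\<close>
    define f2 where "f2 x = of_real (\<chi>2 x) * ((a + b * of_real x)\<^sup>2 - (u1 x)\<^sup>2) * p x
        - 4 * of_real (q x) * u2 x * p x" for x
    have "integrable leb01 (\<lambda>x. of_real (\<chi>2 x) * ((a + b * of_real x)\<^sup>2 * p x))"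
      by (intro integrable_bounded_mult_continuous[OF meas(1) bound(2)] continuous_intros pc)
    then have if1: "integrable leb01 f1" by (simp add: f1_def[abs_def] mult.assoc)
    have iB: "integrable leb01 (\<lambda>x. 1 / \<omega>\<^sup>2 * (B x * p x))"
      by (intro integrable_mult_right square_integrable_mult_integrable B square_integrable_continuous pc)
    have "f2 x = f1 x - 1 / \<omega>\<^sup>2 * (B x * p x)" for x
      using \<omega> by (simp add: f1_def f2_def B_def field_simps)
    then have "(LINT x|leb01. f2 x) = (LINT x|leb01. f1 x) - (LINT x|leb01. 1 / \<omega>\<^sup>2 * (B x * p x))"
      by (simp only: Bochner_Integration.integral_diff[OF if1 iB])
    then have "(LINT x|leb01. f1 x) = (LINT x|leb01. f2 x)"
      by (simp only: integral_mult_right_zero Bp mult_zero_right diff_zero)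
    also have "cmod \<dots> \<le> (LINT x|leb01. M * (G * (2 * N)) + 4 * Q * cmod (u2 x))"
    proof (rule LINT_norm_le)
      have "AE x in leb01. cmod (a + b * of_real x) \<le> N"
      proof (rule AE_leb01I)
        fix x :: real assume "0 < x" "x < 1"
        then have "cmod (a + b * of_real x) \<le> cmod a + cmod b"
          by (intro order_trans[OF norm_triangle_ineq]) (simp add: norm_mult mult_left_le)
        then show "cmod (a + b * of_real x) \<le> N" using GU by (simp add: N_def)
      qed
      then show "AE x in leb01. cmod (f2 x) \<le> M * (G * (2 * N)) + 4 * Q * cmod (u2 x)"
        using ab u1N bound(2,3) p1
      proof eventually_elim
        case (elim x)
        have "cmod ((a + b * of_real x)\<^sup>2 - (u1 x)\<^sup>2) = cmod (u1 x - (a + b * of_real x)) * cmod (u1 x + (a + b * of_real x))"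
          unfolding norm_mult[symmetric] by (subst norm_minus_commute) (simp add: power2_eq_square algebra_simps)
        also have "\<dots> \<le> G * (2 * N)"
          using elim GU by (intro mult_mono order_trans[OF norm_triangle_ineq]) auto
        finally have "cmod (of_real (\<chi>2 x) * ((a + b * of_real x)\<^sup>2 - (u1 x)\<^sup>2) * p x) \<le> M * (G * (2 * N)) * 1"
          unfolding norm_mult norm_of_real using elim MQ GU N0 by (intro mult_mono mult_nonneg_nonneg) auto
        moreover have "cmod (4 * of_real (q x) * u2 x * p x) \<le> 4 * Q * cmod (u2 x) * 1"
          unfolding norm_mult norm_of_real using elim MQ by (intro mult_mono mult_nonneg_nonneg) auto
        ultimately show ?case
          unfolding f2_def by (intro order_trans[OF norm_triangle_ineq4]) simp
      qed
    qed (use u2_int in simp)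
    also have "\<dots> = M * (G * (2 * N)) + 4 * Q * (LINT x|leb01. cmod (u2 x))"
      using u2_int by simp
    also have "\<dots> \<le> M * ((s * K * N) * (2 * N)) + 4 * Q * (2 * s * M * N\<^sup>2)"
      using MQ N0 G order_trans[OF u2_L1 U] by (intro add_mono mult_left_mono mult_right_mono) auto
    also have "\<dots> = s * N\<^sup>2 * (8 * Q * M + 2 * M * K)"
      by (simp add: power2_eq_square algebra_simps)
    finally show ?thesis by (simp only: f1_def p_def)
  qed
  define L where "L = (cmod a)\<^sup>2 + (cmod b)\<^sup>2"
  have L0: "0 \<le> L" by (simp add: L_def)
  have "N\<^sup>2 \<le> (2 * (cmod a + cmod b))\<^sup>2" using Nab N0 by (rule power_mono)
  also have "\<dots> \<le> 8 * L"
    using zero_le_power2[of "cmod a - cmod b"] by (simp add: L_def power2_eq_square algebra_simps)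
  finally have NL: "N\<^sup>2 \<le> 8 * L" .
  \<comment> \<open>The two moments are those against the test polynomials 1 and x.\<close>
  have "c * L \<le> s * N\<^sup>2 * (8 * Q * M + 2 * M * K) + s * N\<^sup>2 * (8 * Q * M + 2 * M * K)"
    unfolding L_def using moment[of 1 0] moment[of 0 1]
    by (intro order_trans[OF coercive(2)] add_mono) simp_all
  also have "\<dots> \<le> s * (8 * L) * (8 * Q * M + 2 * M * K) + s * (8 * L) * (8 * Q * M + 2 * M * K)"
    using s NL MQ r0 by (intro add_mono mult_right_mono mult_left_mono) (simp_all add: K_def)
  finally have "(c - s * (16 * (8 * Q * M + 2 * M * K))) * L \<le> 0" by (simp add: algebra_simps)
  then have "L = 0" using small(3) L0 by (simp add: mult_le_0_iff)
  then have "N\<^sup>2 \<le> 0" using NL by simp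
  then have N: "N = 0" by simp
  then have "G = 0" "U = 0" using G U GU by simp_all
  moreover have "l2_norm v1 = 0"
  proof -
    have "AE x in leb01. (cmod (u1 x))\<^sup>2 = 0" using u1N by eventually_elim (simp add: N)
    then have "(LINT x|leb01. (cmod (u1 x))\<^sup>2) = (LINT x|leb01. 0)" by (intro integral_cong_AE) simp_all
    then show ?thesis by (simp add: l2_norm_def u1_def)
  qed
  ultimately show ?thesis by (simp add: G_def U_def)
qed

section \<open>Essential bounds and the choice of \<delta>\<close>

lemma Linf_norm_nonneg: "0 \<le> Linf_norm f"
proof -
  have "AE x in leb01. ereal \<bar>f x\<bar> \<le> Linf_norm f"
    unfolding Linf_norm_def by (rule esssup_AE)
  then have "AE x in leb01. 0 \<le> Linf_norm f"
    by eventually_elim (rule order_trans[rotated], assumption, simp)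
  then show ?thesis by simp
qed

lemma Linf_norm_AE_le:
  assumes "Linf_norm f \<le> ereal C" shows "AE x in leb01. \<bar>f x\<bar> \<le> C"
proof -
  have "AE x in leb01. ereal \<bar>f x\<bar> \<le> Linf_norm f"
    unfolding Linf_norm_def by (rule esssup_AE)
  then show ?thesis
  proof eventually_elim
    case (elim x)
    then have "ereal \<bar>f x\<bar> \<le> ereal C" using assms by (rule order_trans)
    then show ?case by simp
  qed
qed

lemma C1_01_measurable:
  assumes "C1_01 q" shows "q \<in> borel_measurable leb01"
proof -
  have "continuous_on {0..1} q"
    using assms by (auto simp: C1_01_def continuous_on_eq_continuous_within intro: DERIV_continuous)
  then show ?thesis by (intro borel_measurable_integrable integrable_leb01_continuous)
qed

theorem corollary2p6:
  fixes r Q M :: real and \<chi>2 :: "real \<Rightarrow> real"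
  assumes "r > 0" and "Q > 0"
    and "\<chi>2 \<in> borel_measurable leb01" and "AE x in leb01. \<chi>2 x > 0"
  shows "\<exists>\<delta>>0. \<forall>\<chi>1 q \<omega> u.
           \<chi>1 \<in> borel_measurable leb01 \<longrightarrow>
           Linf_norm \<chi>1 + Linf_norm \<chi>2 = ereal M \<longrightarrow>
           C1_01 q \<longrightarrow> Linf_norm q = ereal Q \<longrightarrow>
           0 < cmod \<omega> \<longrightarrow> cmod \<omega> < \<delta> \<longrightarrow>
           u \<in> X_space \<longrightarrow> 0 < norm_X u \<longrightarrow> norm_X u < r \<longrightarrow>
           T_op \<chi>1 \<chi>2 q \<omega> u \<noteq> 0"
proof (cases "0 \<le> M \<and> Linf_norm \<chi>2 \<le> ereal M")
  case False
  \<comment> \<open>If \<open>M\<close> is incompatible with \<open>\<chi>2\<close>, no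
    \<open>\<chi>1\<close> satisfies the hypothesis and any \<delta> will do.\<close>
  have "Linf_norm \<chi>1 + Linf_norm \<chi>2 \<noteq> ereal M" for \<chi>1
  proof
    assume eq: "Linf_norm \<chi>1 + Linf_norm \<chi>2 = ereal M"
    have "0 + Linf_norm \<chi>2 \<le> Linf_norm \<chi>1 + Linf_norm \<chi>2"
      by (intro add_right_mono Linf_norm_nonneg)
    then have "Linf_norm \<chi>2 \<le> ereal M" by (simp add: eq)
    moreover from order_trans[OF Linf_norm_nonneg this] have "0 \<le> M" by simp
    ultimately show False using False by blast
  qed
  then show ?thesis by (intro exI[of _ 1]) simp
next
  case True
  then have M: "0 \<le> M" and \<chi>2: "AE x in leb01. \<bar>\<chi>2 x\<bar> \<le> M" by (auto intro: Linf_norm_AE_le)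
  obtain c where c: "0 < c" "\<And>a b. c * ((cmod a)\<^sup>2 + (cmod b)\<^sup>2) \<le>
      cmod (LINT x|leb01. of_real (\<chi>2 x) * (a + b * of_real x)\<^sup>2)
      + cmod (LINT x|leb01. of_real (\<chi>2 x) * (a + b * of_real x)\<^sup>2 * of_real x)"
    using affine_square_moments_coercive[OF assms(3) \<chi>2 assms(4)] by blast
  define K where "K = 2 * (Q + M * r)"
  define P where "P = 16 * (8 * Q * M + 2 * M * K)"
  \<comment> \<open>\<open>D\<close> adds up the three smallness conditions on s = |\<omega>|^2:
    with \<delta> = sqrt (1 / D) one has s D < 1, and each of the nonnegative terms 2 s K, 8 Q s and
    s P / c is then below 1. Only \<open>r\<close>, \<open>Q\<close>, \<open>M\<close> and, through
    \<open>c\<close>, the function \<open>\<chi>2\<close> enter.\<close>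
  define D where "D = 2 * K + 8 * Q + P / c"
  have pos: "0 < K" "0 \<le> P" using assms(1,2) M by (auto simp: K_def P_def intro!: add_pos_nonneg)
  then have D: "0 < D" using assms(2) c(1) by (simp add: D_def add_pos_nonneg)
  show ?thesis
  proof (intro exI[of _ "sqrt (1 / D)"] conjI allI impI notI)
    show "0 < sqrt (1 / D)" using D by simp
  next
    fix \<chi>1 q :: "real \<Rightarrow> real" and \<omega> u
    assume \<chi>1: "\<chi>1 \<in> borel_measurable leb01" and sum: "Linf_norm \<chi>1 + Linf_norm \<chi>2 = ereal M"
      and q: "C1_01 q" "Linf_norm q = ereal Q"
      and \<omega>: "0 < cmod \<omega>" "cmod \<omega> < sqrt (1 / D)"
      and u: "u \<in> X_space" "0 < norm_X u" "norm_X u < r"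
      and T: "T_op \<chi>1 \<chi>2 q \<omega> u = 0"
    have "Linf_norm \<chi>1 + 0 \<le> Linf_norm \<chi>1 + Linf_norm \<chi>2"
      by (intro add_left_mono Linf_norm_nonneg)
    then have \<chi>1M: "AE x in leb01. \<bar>\<chi>1 x\<bar> \<le> M" by (intro Linf_norm_AE_le) (simp add: sum)
    have qQ: "AE x in leb01. \<bar>q x\<bar> \<le> Q" by (intro Linf_norm_AE_le) (simp add: q)
    note qm = C1_01_measurable[OF q(1)]
    note T0 = T_op_eq_0D[OF u(1) \<chi>1 assms(3) qm \<chi>1M \<chi>2 qQ T]
    define s where "s = (cmod \<omega>)\<^sup>2"
    have "s < (sqrt (1 / D))\<^sup>2" unfolding s_def using \<omega> by (intro power_strict_mono) auto
    then have "s * D < 1" using D by (simp add: field_simps)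
    then have "2 * (s * K) + 2 * (4 * Q * s) + s * P / c < 1" by (simp add: D_def algebra_simps)
    moreover have "0 \<le> s * K" "0 \<le> 4 * Q * s" "0 \<le> s * P / c"
      using pos c(1) assms(2) by (simp_all add: s_def)
    ultimately have small: "s * K \<le> 1/2" "4 * Q * s \<le> 1/2" "s * P / c < 1" by linarith+
    have u2r: "l2_norm (snd u) \<le> r"
    proof (rule power2_le_imp_le)
      have "(l2_norm (snd u))\<^sup>2 \<le> (norm_X u)\<^sup>2" by (simp add: norm_X_power2)
      also have "\<dots> \<le> r\<^sup>2" using u by (intro power_mono) auto
      finally show "(l2_norm (snd u))\<^sup>2 \<le> r\<^sup>2" .
    qed (use assms(1) in simp)
    have "l2_norm (fst u) = 0 \<and> l2_norm (weak_deriv2 (fst u)) = 0 \<and> l2_norm (snd u) = 0"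
    proof (rule small_solution_zero[OF _ assms(3) qm \<chi>1M \<chi>2 qQ M _ T0 c u2r \<omega>(1)])
      show "fst u \<in> H2" using u(1) by (auto simp: X_space_def)
      show "(cmod \<omega>)\<^sup>2 * (2 * (Q + M * r)) \<le> 1/2" "4 * Q * (cmod \<omega>)\<^sup>2 \<le> 1/2"
        using small by (simp_all only: s_def K_def)
      show "(cmod \<omega>)\<^sup>2 * (16 * (8 * Q * M + 2 * M * (2 * (Q + M * r)))) < c"
        using small(3) c(1) by (simp only: s_def P_def K_def divide_less_eq_1_pos)
    qed (use assms(2) in simp_all)
    then have "(norm_X u)\<^sup>2 = 0" by (simp add: norm_X_power2)
    with u(2) show False by simp
  qed
qed

end
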